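(* Let $\pi:(M,g)\to (N,h)$ be a harmonic Riemannian submersion between Riemannian manifolds and let $\widetilde{h}=e^{2\rho}h$, $\rho\in C^\infty(N)$, be a conformal change of the metric on $(N,h)$. Let $\mathbf{1}:(N,h)\to (N,\widetilde{h})$ be the identity map and put $\widetilde{\pi}=\mathbf{1}\circ\pi:(M,g)\to(N,\widetilde{h})$. Then $\widetilde\pi$ is nonharmonic and biharmonic if and only if $\mathbf{1}$ is nonharmonic and biharmonic.
   Context: For a smooth map $\phi:(M,g)\to(N,h)$ between Riemannian manifolds, the tension field is $\tau(\phi)=\operatorname{trace}_g\nabla d\phi$, a section of $\phi^{-1}TN$; $\phi$ is harmonic if $\tau(\phi)=0$ and nonharmonic otherwise. The map $\phi$ is biharmonic if it is a critical point of the bienergy $E_2(\phi)=\frac12\int_K|\tau(\phi)|^2v_g$ ($K\subseteq M$ compact domains), equivalently if $\tau_2(\phi)=0$, where $$\tau_2(\phi)=-\Delta^\phi\tau(\phi)-\operatorname{trace}_g R^N(d\phi\,\cdot,\tau(\phi))d\phi\,\cdot,$$ $\Delta^\phi=-\operatorname{trace}_g(\nabla^\phi)^2$ is the Laplacian on sections of the pull-back bundle $\phi^{-1}TN$ and $R^N(X,Y)=[\nabla^N_X,\nabla^N_Y]-\nabla^N_{[X,Y]}$. *)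

theory Defs
  imports "HOL-Analysis.Analysis"
begin

section \<open>Smooth manifolds\<close>

abbreviation dd :: "('a::real_normed_vector \<Rightarrow> 'b::real_normed_vector) \<Rightarrow> 'a \<Rightarrow> 'a \<Rightarrow> 'b"
  where "dd f x v \<equiv> frechet_derivative f (at x) v"

text \<open>Used only for open \<open>S\<close> in finite-dimensional spaces, where it is the usual notion of \<open>C\<^sup>k\<close>.\<close>

fun Ck_on :: "nat \<Rightarrow> 'a::real_normed_vector set \<Rightarrow> ('a \<Rightarrow> 'b::real_normed_vector) \<Rightarrow> bool" where
  "Ck_on 0 S f \<longleftrightarrow> continuous_on S f"
| "Ck_on (Suc k) S f \<longleftrightarrow> (\<forall>x\<in>S. f differentiable (at x)) \<and> (\<forall>v. Ck_on k S (\<lambda>x. dd f x v))"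

definition smooth_on :: "'a::real_normed_vector set \<Rightarrow> ('a \<Rightarrow> 'b::real_normed_vector) \<Rightarrow> bool" where
  "smooth_on S f \<longleftrightarrow> (\<forall>k. Ck_on k S f)"

text \<open>A chart is a pair of its domain and its coordinate map; the values of the coordinate map
  outside the domain are irrelevant. The manifold itself is \<open>topspace (topo M)\<close>. The atlas need
  not be maximal.\<close>

type_synonym ('m, 'e) chart = "'m set \<times> ('m \<Rightarrow> 'e)"

record ('m, 'e) manifold =
  topo :: "'m topology"
  atlas :: "('m, 'e) chart set"

abbreviation chart_inv :: "('m, 'e) chart \<Rightarrow> 'e \<Rightarrow> 'm" where
  "chart_inv c \<equiv> inv_into (fst c) (snd c)"

definition chart_rep :: "('m, 'e) chart \<Rightarrow> ('n, 'f) chart \<Rightarrow> ('m \<Rightarrow> 'n) \<Rightarrow> 'e \<Rightarrow> 'f" where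
  "chart_rep c d \<phi> = snd d \<circ> \<phi> \<circ> chart_inv c"

definition smooth_manifold :: "('m, 'e::euclidean_space) manifold \<Rightarrow> bool" where
  "smooth_manifold M \<longleftrightarrow>
     Hausdorff_space (topo M) \<and> second_countable (topo M) \<and>
     topspace (topo M) = (\<Union>c\<in>atlas M. fst c) \<and>
     (\<forall>c\<in>atlas M. openin (topo M) (fst c) \<and> open (snd c ` fst c) \<and>
        homeomorphic_map (subtopology (topo M) (fst c)) (top_of_set (snd c ` fst c)) (snd c)) \<and>
     (\<forall>c\<in>atlas M. \<forall>c'\<in>atlas M. smooth_on (snd c ` (fst c \<inter> fst c')) (chart_rep c c' id))"

definition smooth_map ::
  "('m, 'e::euclidean_space) manifold \<Rightarrow> ('n, 'f::euclidean_space) manifold \<Rightarrow> ('m \<Rightarrow> 'n) \<Rightarrow> bool" where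
  "smooth_map M N \<phi> \<longleftrightarrow>
     continuous_map (topo M) (topo N) \<phi> \<and>
     (\<forall>c\<in>atlas M. \<forall>d\<in>atlas N. smooth_on (snd c ` (fst c \<inter> \<phi> -` fst d)) (chart_rep c d \<phi>))"

definition smooth_fun :: "('m, 'e::euclidean_space) manifold \<Rightarrow> ('m \<Rightarrow> real) \<Rightarrow> bool" where
  "smooth_fun M \<rho> \<longleftrightarrow> (\<forall>c\<in>atlas M. smooth_on (snd c ` fst c) (\<rho> \<circ> chart_inv c))"

text \<open>\<open>chart_diff c d \<phi> p\<close> is the differential of \<open>\<phi>\<close> at \<open>p\<close>, where tangent vectors at \<open>p\<close> are
  represented by their components in \<open>c\<close> and those at \<open>\<phi> p\<close> by their components in \<open>d\<close>.\<close>

definition chart_diff ::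
  "('m, 'e::euclidean_space) chart \<Rightarrow> ('n, 'f::euclidean_space) chart \<Rightarrow> ('m \<Rightarrow> 'n) \<Rightarrow> 'm \<Rightarrow> 'e \<Rightarrow> 'f" where
  "chart_diff c d \<phi> p v = dd (chart_rep c d \<phi>) (snd c p) v"


section \<open>Riemannian metrics\<close>

text \<open>A covariant 2-tensor field is given by its components in every chart: \<open>g c p u v\<close> is its value
  at \<open>p\<close> on the tangent vectors whose components in the chart \<open>c\<close> are \<open>u\<close> and \<open>v\<close>. The last
  condition below is the tensor transformation law.\<close>

type_synonym ('m, 'e) tensor2 = "('m, 'e) chart \<Rightarrow> 'm \<Rightarrow> 'e \<Rightarrow> 'e \<Rightarrow> real"

definition riemannian_metric ::
  "('m, 'e::euclidean_space) manifold \<Rightarrow> ('m, 'e) tensor2 \<Rightarrow> bool" where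
  "riemannian_metric M g \<longleftrightarrow>
     (\<forall>c\<in>atlas M. \<forall>p\<in>fst c.
        bilinear (g c p) \<and> (\<forall>u v. g c p u v = g c p v u) \<and> (\<forall>u. u \<noteq> 0 \<longrightarrow> g c p u u > 0)) \<and>
     (\<forall>c\<in>atlas M. \<forall>u v. smooth_on (snd c ` fst c) (\<lambda>x. g c (chart_inv c x) u v)) \<and>
     (\<forall>c\<in>atlas M. \<forall>c'\<in>atlas M. \<forall>p\<in>fst c \<inter> fst c'. \<forall>u v.
        g c p u v = g c' p (chart_diff c c' id p u) (chart_diff c c' id p v))"

definition conformal_change :: "('m \<Rightarrow> real) \<Rightarrow> ('m, 'e) tensor2 \<Rightarrow> ('m, 'e) tensor2" where
  "conformal_change \<rho> h = (\<lambda>c p u v. exp (2 * \<rho> p) * h c p u v)"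

definition metric_rep :: "('m, 'e) tensor2 \<Rightarrow> ('m, 'e) chart \<Rightarrow> 'e \<Rightarrow> 'e \<Rightarrow> 'e \<Rightarrow> real" where
  "metric_rep g c = (\<lambda>x. g c (chart_inv c x))"

text \<open>Horizontal vectors are those orthogonal to the kernel of the differential.
  Submersions are surjective maps, as usual in the theory of Riemannian submersions.\<close>

definition horizontal ::
  "('m, 'e::euclidean_space) tensor2 \<Rightarrow> ('m, 'e) chart \<Rightarrow> ('n, 'f::euclidean_space) chart
     \<Rightarrow> ('m \<Rightarrow> 'n) \<Rightarrow> 'm \<Rightarrow> 'e set" where
  "horizontal g c d \<pi> p = {u. \<forall>w. chart_diff c d \<pi> p w = 0 \<longrightarrow> g c p u w = 0}"

definition riemannian_submersion ::
  "('m, 'e::euclidean_space) manifold \<Rightarrow> ('m, 'e) tensor2 \<Rightarrow>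
   ('n, 'f::euclidean_space) manifold \<Rightarrow> ('n, 'f) tensor2 \<Rightarrow> ('m \<Rightarrow> 'n) \<Rightarrow> bool" where
  "riemannian_submersion M g N h \<pi> \<longleftrightarrow>
     smooth_map M N \<pi> \<and> \<pi> ` topspace (topo M) = topspace (topo N) \<and>
     (\<forall>c\<in>atlas M. \<forall>d\<in>atlas N. \<forall>p\<in>fst c \<inter> \<pi> -` fst d.
        surj (chart_diff c d \<pi> p) \<and>
        (\<forall>u\<in>horizontal g c d \<pi> p. \<forall>v\<in>horizontal g c d \<pi> p.
           h d (\<pi> p) (chart_diff c d \<pi> p u) (chart_diff c d \<pi> p v) = g c p u v))"


section \<open>Connections, tension and bitension fields in local coordinates\<close>

text \<open>Here \<open>G\<close> and \<open>H\<close> are metrics on open subsets of the model spaces, and vector fields and sections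
  of pull-back bundles are functions into the model spaces.\<close>

type_synonym 'e metric = "'e \<Rightarrow> 'e \<Rightarrow> 'e \<Rightarrow> real"

definition sharp :: "('e \<Rightarrow> 'e \<Rightarrow> real) \<Rightarrow> ('e \<Rightarrow> real) \<Rightarrow> 'e" where
  "sharp b \<alpha> = (THE w. \<forall>z. b w z = \<alpha> z)"

text \<open>\<open>trace_wrt b B\<close> is \<open>\<Sum>\<^sub>i\<^sub>j b\<^sup>i\<^sup>j B(\<partial>\<^sub>i, \<partial>\<^sub>j)\<close>: the vector \<open>\<Sum>\<^sub>j b\<^sup>i\<^sup>j \<partial>\<^sub>j\<close> is obtained by raising the index
  of the coordinate covector dual to \<open>\<partial>\<^sub>i\<close>.\<close>

definition trace_wrt ::
  "('e::euclidean_space \<Rightarrow> 'e \<Rightarrow> real) \<Rightarrow> ('e \<Rightarrow> 'e \<Rightarrow> 'f::real_vector) \<Rightarrow> 'f" where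
  "trace_wrt b B = (\<Sum>i\<in>Basis. B i (sharp b (\<lambda>z. i \<bullet> z)))"

text \<open>\<open>christoffel G x u v\<close> is \<open>\<Gamma>\<^sup>k\<^sub>i\<^sub>j u\<^sup>i v\<^sup>j \<partial>\<^sub>k\<close> at \<open>x\<close>, i.e. \<open>\<nabla>\<^sub>u v\<close> for constant vector fields \<open>u\<close>, \<open>v\<close>,
  given by the Koszul formula (in which the brackets of constant fields vanish).\<close>

definition christoffel :: "'e::euclidean_space metric \<Rightarrow> 'e \<Rightarrow> 'e \<Rightarrow> 'e \<Rightarrow> 'e" where
  "christoffel G x u v = sharp (G x)
     (\<lambda>z. (dd (\<lambda>y. G y v z) x u + dd (\<lambda>y. G y u z) x v - dd (\<lambda>y. G y u v) x z) / 2)"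

text \<open>The Levi-Civita connection: \<open>levi_civita G X Y\<close> is \<open>\<nabla>\<^sub>X Y\<close>.\<close>

definition levi_civita ::
  "'e::euclidean_space metric \<Rightarrow> ('e \<Rightarrow> 'e) \<Rightarrow> ('e \<Rightarrow> 'e) \<Rightarrow> 'e \<Rightarrow> 'e" where
  "levi_civita G X Y = (\<lambda>x. dd Y x (X x) + christoffel G x (X x) (Y x))"

definition lie_bracket :: "('e::euclidean_space \<Rightarrow> 'e) \<Rightarrow> ('e \<Rightarrow> 'e) \<Rightarrow> 'e \<Rightarrow> 'e" where
  "lie_bracket X Y = (\<lambda>x. dd Y x (X x) - dd X x (Y x))"

text \<open>\<open>curvature G X Y Z\<close> is \<open>R(X,Y)Z\<close>; by tensoriality, the value on tangent vectors at a point is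
  computed with constant extensions.\<close>

definition curvature ::
  "'e::euclidean_space metric \<Rightarrow> ('e \<Rightarrow> 'e) \<Rightarrow> ('e \<Rightarrow> 'e) \<Rightarrow> ('e \<Rightarrow> 'e) \<Rightarrow> 'e \<Rightarrow> 'e" where
  "curvature G X Y Z = (\<lambda>x.
     levi_civita G X (levi_civita G Y Z) x - levi_civita G Y (levi_civita G X Z) x
     - levi_civita G (lie_bracket X Y) Z x)"

definition curvature_at ::
  "'e::euclidean_space metric \<Rightarrow> 'e \<Rightarrow> 'e \<Rightarrow> 'e \<Rightarrow> 'e \<Rightarrow> 'e" where
  "curvature_at G x u v w = curvature G (\<lambda>_. u) (\<lambda>_. v) (\<lambda>_. w) x"

text \<open>The connection \<open>\<nabla>\<^sup>f\<close> on the pull-back bundle: \<open>pullback_conn H f X V\<close> is \<open>\<nabla>\<^sup>f\<^sub>X V\<close>, where \<open>V\<close> is a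
  section along \<open>f\<close>.\<close>

definition pullback_conn ::
  "'f::euclidean_space metric \<Rightarrow> ('e::euclidean_space \<Rightarrow> 'f) \<Rightarrow> ('e \<Rightarrow> 'e) \<Rightarrow> ('e \<Rightarrow> 'f) \<Rightarrow> 'e \<Rightarrow> 'f" where
  "pullback_conn H f X V = (\<lambda>x. dd V x (X x) + christoffel H (f x) (dd f x (X x)) (V x))"

text \<open>\<open>(\<nabla>df)(u,v) = \<nabla>\<^sup>f\<^sub>u(df(v)) - df(\<nabla>\<^sub>u v)\<close> at \<open>x\<close>.\<close>

definition second_fundamental_form ::
  "'e::euclidean_space metric \<Rightarrow> 'f::euclidean_space metric \<Rightarrow> ('e \<Rightarrow> 'f) \<Rightarrow> 'e \<Rightarrow> 'e \<Rightarrow> 'e \<Rightarrow> 'f" where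
  "second_fundamental_form G H f x u v =
     pullback_conn H f (\<lambda>_. u) (\<lambda>y. dd f y v) x - dd f x (levi_civita G (\<lambda>_. u) (\<lambda>_. v) x)"

definition tension ::
  "'e::euclidean_space metric \<Rightarrow> 'f::euclidean_space metric \<Rightarrow> ('e \<Rightarrow> 'f) \<Rightarrow> 'e \<Rightarrow> 'f" where
  "tension G H f = (\<lambda>x. trace_wrt (G x) (second_fundamental_form G H f x))"

text \<open>\<open>((\<nabla>\<^sup>f)\<^sup>2 V)(u,v) = \<nabla>\<^sup>f\<^sub>u \<nabla>\<^sup>f\<^sub>v V - \<nabla>\<^sup>f\<^bsub>\<nabla>\<^sub>u v\<^esub> V\<close> at \<open>x\<close>.\<close>

definition second_cov_deriv ::
  "'e::euclidean_space metric \<Rightarrow> 'f::euclidean_space metric \<Rightarrow> ('e \<Rightarrow> 'f) \<Rightarrow> ('e \<Rightarrow> 'f)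
     \<Rightarrow> 'e \<Rightarrow> 'e \<Rightarrow> 'e \<Rightarrow> 'f" where
  "second_cov_deriv G H f V x u v =
     pullback_conn H f (\<lambda>_. u) (pullback_conn H f (\<lambda>_. v) V) x
     - pullback_conn H f (levi_civita G (\<lambda>_. u) (\<lambda>_. v)) V x"

definition rough_laplacian ::
  "'e::euclidean_space metric \<Rightarrow> 'f::euclidean_space metric \<Rightarrow> ('e \<Rightarrow> 'f) \<Rightarrow> ('e \<Rightarrow> 'f) \<Rightarrow> 'e \<Rightarrow> 'f" where
  "rough_laplacian G H f V = (\<lambda>x. - trace_wrt (G x) (second_cov_deriv G H f V x))"

definition bitension ::
  "'e::euclidean_space metric \<Rightarrow> 'f::euclidean_space metric \<Rightarrow> ('e \<Rightarrow> 'f) \<Rightarrow> 'e \<Rightarrow> 'f" where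
  "bitension G H f = (\<lambda>x. - rough_laplacian G H f (tension G H f) x
     - trace_wrt (G x) (\<lambda>u v. curvature_at H (f x) (dd f x u) (tension G H f x) (dd f x v)))"


section \<open>Harmonic and biharmonic maps\<close>

text \<open>The components at \<open>p\<close>, in the chart \<open>d\<close> of \<open>N\<close>, of the tension and bitension fields of \<open>\<phi>\<close>,
  computed in the chart \<open>c\<close> of \<open>M\<close>. A section of the pull-back bundle vanishes iff its components
  vanish in all charts.\<close>

definition tension_field ::
  "('m, 'e::euclidean_space) tensor2 \<Rightarrow> ('n, 'f::euclidean_space) tensor2 \<Rightarrow> ('m \<Rightarrow> 'n)
     \<Rightarrow> ('m, 'e) chart \<Rightarrow> ('n, 'f) chart \<Rightarrow> 'm \<Rightarrow> 'f" where
  "tension_field g h \<phi> c d p = tension (metric_rep g c) (metric_rep h d) (chart_rep c d \<phi>) (snd c p)"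

definition bitension_field ::
  "('m, 'e::euclidean_space) tensor2 \<Rightarrow> ('n, 'f::euclidean_space) tensor2 \<Rightarrow> ('m \<Rightarrow> 'n)
     \<Rightarrow> ('m, 'e) chart \<Rightarrow> ('n, 'f) chart \<Rightarrow> 'm \<Rightarrow> 'f" where
  "bitension_field g h \<phi> c d p = bitension (metric_rep g c) (metric_rep h d) (chart_rep c d \<phi>) (snd c p)"

definition harmonic_map ::
  "('m, 'e::euclidean_space) manifold \<Rightarrow> ('m, 'e) tensor2 \<Rightarrow>
   ('n, 'f::euclidean_space) manifold \<Rightarrow> ('n, 'f) tensor2 \<Rightarrow> ('m \<Rightarrow> 'n) \<Rightarrow> bool" where
  "harmonic_map M g N h \<phi> \<longleftrightarrow> smooth_map M N \<phi> \<and>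
     (\<forall>c\<in>atlas M. \<forall>d\<in>atlas N. \<forall>p\<in>fst c \<inter> \<phi> -` fst d. tension_field g h \<phi> c d p = 0)"

definition nonharmonic_map ::
  "('m, 'e::euclidean_space) manifold \<Rightarrow> ('m, 'e) tensor2 \<Rightarrow>
   ('n, 'f::euclidean_space) manifold \<Rightarrow> ('n, 'f) tensor2 \<Rightarrow> ('m \<Rightarrow> 'n) \<Rightarrow> bool" where
  "nonharmonic_map M g N h \<phi> \<longleftrightarrow> smooth_map M N \<phi> \<and> \<not> harmonic_map M g N h \<phi>"

definition biharmonic_map ::
  "('m, 'e::euclidean_space) manifold \<Rightarrow> ('m, 'e) tensor2 \<Rightarrow>
   ('n, 'f::euclidean_space) manifold \<Rightarrow> ('n, 'f) tensor2 \<Rightarrow> ('m \<Rightarrow> 'n) \<Rightarrow> bool" where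
  "biharmonic_map M g N h \<phi> \<longleftrightarrow> smooth_map M N \<phi> \<and>
     (\<forall>c\<in>atlas M. \<forall>d\<in>atlas N. \<forall>p\<in>fst c \<inter> \<phi> -` fst d. bitension_field g h \<phi> c d p = 0)"

end

theory Submission
  imports Defs
begin

text \<open>Write \<open>\<psi>\<close> for any map defined on \<open>(N, h)\<close>. For a Riemannian submersion \<open>\<pi>\<close>,
  \<open>trace\<^sub>g B(d\<pi>, d\<pi>) = trace\<^sub>h B\<close> for every bilinear \<open>B\<close>; if \<open>\<pi>\<close> is moreover harmonic, the terms of the chain
  rule that involve \<open>\<nabla>d\<pi>\<close> vanish after taking the trace. Therefore
  \<open>\<tau>(\<psi> \<circ> \<pi>) = \<tau>(\<psi>) \<circ> \<pi>\<close> and, by the same argument applied to \<open>\<tau>(\<psi>)\<close> as a section,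
  \<open>\<tau>\<^sub>2(\<psi> \<circ> \<pi>) = \<tau>\<^sub>2(\<psi>) \<circ> \<pi>\<close>; since \<open>\<pi>\<close> is surjective, either side vanishes identically iff the other
  does. In charts \<open>c\<close> of \<open>M\<close> and \<open>d\<close>, \<open>d'\<close> of \<open>N\<close> this is applied to \<open>f\<close>, the representation of \<open>\<pi>\<close> in
  \<open>c\<close>, \<open>d\<close>, and to \<open>\<psi>\<close>, the representation of the identity in \<open>d\<close>, \<open>d'\<close>, so that no transformation law
  for the two fields is needed.\<close>

subsection \<open>Differentials\<close>

lemma dd_eqI: "(f has_derivative f') (at x) \<Longrightarrow> dd f x v = f' v"
  using frechet_derivative_at by metis

lemma has_derivative_dd: "f differentiable (at x) \<Longrightarrow> (f has_derivative dd f x) (at x)"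
  by (simp add: frechet_derivative_works)

lemma has_derivative_cong_open:
  assumes "open S" "x \<in> S" "\<And>y. y \<in> S \<Longrightarrow> f y = g y"
  shows "(f has_derivative f') (at x) \<longleftrightarrow> (g has_derivative f') (at x)"
  using has_derivative_transform_within_open[OF _ assms(1,2)] assms(3) by metis

lemma dd_cong_open:
  assumes "open S" "x \<in> S" "\<And>y. y \<in> S \<Longrightarrow> f y = g y"
  shows "dd f x v = dd g x v"
  unfolding frechet_derivative_def using has_derivative_cong_open[OF assms] by simp

lemma dd_const: "dd (\<lambda>_. c) x v = 0"
  by (rule dd_eqI[where f' = "\<lambda>_. 0"]) simp

lemma linear_basis_expansion:
  fixes f :: "'a::euclidean_space \<Rightarrow> 'b::real_vector"
  assumes "linear f"
  shows "f u = (\<Sum>i\<in>Basis. (u \<bullet> i) *\<^sub>R f i)"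
proof -
  have "f u = f (\<Sum>i\<in>Basis. (u \<bullet> i) *\<^sub>R i)" by (simp add: euclidean_representation)
  then show ?thesis using assms by (simp only: linear_sum linear_cmul)
qed

lemma has_derivative_linear_family:
  fixes Q :: "'b::real_normed_vector \<Rightarrow> 'a::euclidean_space \<Rightarrow> 'c::real_normed_vector"
    and f :: "'d::real_normed_vector \<Rightarrow> 'b"
  assumes "open S" "x \<in> S" "open V" "f ` S \<subseteq> V"
    and lin: "\<And>q. q \<in> V \<Longrightarrow> linear (Q q)"
    and dQ: "\<And>w. (\<lambda>q. Q q w) differentiable (at (f x))"
    and df: "(f has_derivative f') (at x)" and da: "(a has_derivative a') (at x)"
  shows "((\<lambda>y. Q (f y) (a y)) has_derivative
     (\<lambda>u. Q (f x) (a' u) + dd (\<lambda>q. Q q (a x)) (f x) (f' u))) (at x)"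
proof -
  have expand: "Q q w = (\<Sum>i\<in>Basis. (w \<bullet> i) *\<^sub>R Q q i)" if "q \<in> V" for q w
    by (rule linear_basis_expansion[OF lin[OF that]])
  have fxV: "f x \<in> V" using assms by auto
  have dQi: "((\<lambda>y. Q (f y) i) has_derivative (\<lambda>u. dd (\<lambda>q. Q q i) (f x) (f' u))) (at x)" for i
    by (rule has_derivative_compose[OF df has_derivative_dd[OF dQ]])
  have D: "((\<lambda>y. \<Sum>i\<in>Basis. (a y \<bullet> i) *\<^sub>R Q (f y) i) has_derivative
     (\<lambda>u. \<Sum>i\<in>Basis. (a x \<bullet> i) *\<^sub>R dd (\<lambda>q. Q q i) (f x) (f' u) + (a' u \<bullet> i) *\<^sub>R Q (f x) i)) (at x)"
    by (intro has_derivative_sum has_derivative_scaleR has_derivative_inner_left da dQi)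
  have E: "dd (\<lambda>q. Q q w) (f x) v = (\<Sum>i\<in>Basis. (w \<bullet> i) *\<^sub>R dd (\<lambda>q. Q q i) (f x) v)" for w v
  proof -
    have "dd (\<lambda>q. Q q w) (f x) v = dd (\<lambda>q. \<Sum>i\<in>Basis. (w \<bullet> i) *\<^sub>R Q q i) (f x) v"
      by (rule dd_cong_open[OF \<open>open V\<close> fxV expand])
    also have "\<dots> = (\<Sum>i\<in>Basis. (w \<bullet> i) *\<^sub>R dd (\<lambda>q. Q q i) (f x) v)"
      by (rule dd_eqI) (intro has_derivative_sum has_derivative_scaleR_right has_derivative_dd dQ)
    finally show ?thesis .
  qed
  have "(\<lambda>u. \<Sum>i\<in>Basis. (a x \<bullet> i) *\<^sub>R dd (\<lambda>q. Q q i) (f x) (f' u) + (a' u \<bullet> i) *\<^sub>R Q (f x) i)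
      = (\<lambda>u. Q (f x) (a' u) + dd (\<lambda>q. Q q (a x)) (f x) (f' u))"
    unfolding E[of "a x"] by (subst expand[OF fxV]) (simp add: sum.distrib add.commute)
  with D have D': "((\<lambda>y. \<Sum>i\<in>Basis. (a y \<bullet> i) *\<^sub>R Q (f y) i) has_derivative
     (\<lambda>u. Q (f x) (a' u) + dd (\<lambda>q. Q q (a x)) (f x) (f' u))) (at x)" by simp
  show ?thesis
    by (rule has_derivative_transform_within_open[OF D' \<open>open S\<close> \<open>x \<in> S\<close>])
      (use expand assms(4) in auto)
qed

lemma linear_dd:
  assumes "open S" "x \<in> S" and lin: "\<And>y. y \<in> S \<Longrightarrow> linear (Q y)"
    and dQ: "\<And>u. (\<lambda>y. Q y u) differentiable (at x)"
  shows "linear (\<lambda>u. dd (\<lambda>y. Q y u) x w)"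
proof (rule linearI)
  fix u v
  have "dd (\<lambda>y. Q y (u + v)) x w = dd (\<lambda>y. Q y u + Q y v) x w"
    by (rule dd_cong_open[OF assms(1,2)]) (simp add: linear_add lin)
  also have "\<dots> = dd (\<lambda>y. Q y u) x w + dd (\<lambda>y. Q y v) x w"
    by (rule dd_eqI) (intro has_derivative_add has_derivative_dd dQ)
  finally show "dd (\<lambda>y. Q y (u + v)) x w = dd (\<lambda>y. Q y u) x w + dd (\<lambda>y. Q y v) x w" .
next
  fix r u
  have "dd (\<lambda>y. Q y (r *\<^sub>R u)) x w = dd (\<lambda>y. r *\<^sub>R Q y u) x w"
    by (rule dd_cong_open[OF assms(1,2)]) (simp add: linear_cmul lin)
  also have "\<dots> = r *\<^sub>R dd (\<lambda>y. Q y u) x w"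
    by (rule dd_eqI) (intro has_derivative_scaleR_right has_derivative_dd dQ)
  finally show "dd (\<lambda>y. Q y (r *\<^sub>R u)) x w = r *\<^sub>R dd (\<lambda>y. Q y u) x w" .
qed

lemma bilinear_dd:
  assumes "open S" "x \<in> S" and "\<And>y. y \<in> S \<Longrightarrow> bilinear (Q y)"
    and "\<And>u v. (\<lambda>y. Q y u v) differentiable (at x)"
  shows "bilinear (\<lambda>u v. dd (\<lambda>y. Q y u v) x w)"
  unfolding bilinear_def
  by (intro conjI allI linear_dd[OF assms(1,2)] assms(4))
     (use assms(3) in \<open>auto simp: bilinear_def\<close>)

lemma linear_dd_arg: "f differentiable (at x) \<Longrightarrow> linear (dd f x)"
  using has_derivative_dd has_derivative_linear by blast

subsection \<open>Functions of class \<open>C\<^sup>k\<close>\<close>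

lemma Ck_on_cong:
  assumes "open S" "\<And>x. x \<in> S \<Longrightarrow> f x = g x" "Ck_on k S f"
  shows "Ck_on k S g"
  using assms(2,3)
proof (induction k arbitrary: f g)
  case 0
  then show ?case using continuous_on_eq by (metis Ck_on.simps(1))
next
  case (Suc k)
  have 1: "g differentiable (at x)" if "x \<in> S" for x
    using has_derivative_cong_open[OF \<open>open S\<close> that, of f g] Suc.prems that
    unfolding differentiable_def Ck_on.simps by blast
  have 2: "Ck_on k S (\<lambda>x. dd g x v)" for v
    by (rule Suc.IH[of "\<lambda>x. dd f x v"])
       (use Suc.prems dd_cong_open[OF \<open>open S\<close> _ Suc.prems(1)] in auto)
  show ?case using 1 2 by simp
qed

lemma Ck_on_SucI:
  assumes "open S" "\<And>x. x \<in> S \<Longrightarrow> (f has_derivative f' x) (at x)" "\<And>v. Ck_on k S (\<lambda>x. f' x v)"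
  shows "Ck_on (Suc k) S f"
proof -
  have "Ck_on k S (\<lambda>x. dd f x v)" for v
    by (rule Ck_on_cong[OF assms(1) _ assms(3)[of v]]) (simp add: dd_eqI[OF assms(2)])
  then show ?thesis using assms(2) by (auto simp: differentiable_def)
qed

lemma Ck_on_SucD: "Ck_on (Suc k) S f \<Longrightarrow> x \<in> S \<Longrightarrow> (f has_derivative dd f x) (at x)"
  by (simp add: has_derivative_dd)

lemma Ck_on_pred: "Ck_on (Suc k) S f \<Longrightarrow> Ck_on k S f"
proof (induction k arbitrary: f)
  case 0
  then show ?case
    by (auto simp: continuous_on_eq_continuous_within
        intro: differentiable_imp_continuous_within differentiable_at_withinI)
next
  case (Suc k)
  have "Ck_on k S (\<lambda>x. dd f x v)" for v
    by (rule Suc.IH) (use Suc.prems Ck_on.simps(2)[of "Suc k" S f] in blast)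
  moreover have "\<forall>x\<in>S. f differentiable (at x)" using Suc.prems by simp
  ultimately show ?case unfolding Ck_on.simps(2) by blast
qed

lemma Ck_on_subset: "T \<subseteq> S \<Longrightarrow> Ck_on k S f \<Longrightarrow> Ck_on k T f"
  by (induction k arbitrary: f) (auto intro: continuous_on_subset)

lemma Ck_on_const: "open S \<Longrightarrow> Ck_on k S (\<lambda>_. c)"
proof (induction k arbitrary: c)
  case (Suc k)
  show ?case by (rule Ck_on_SucI[where f' = "\<lambda>_ _. 0"]) (use Suc in auto)
qed auto

lemma Ck_on_add: "open S \<Longrightarrow> Ck_on k S f \<Longrightarrow> Ck_on k S g \<Longrightarrow> Ck_on k S (\<lambda>x. f x + g x)"
proof (induction k arbitrary: f g)
  case (Suc k)
  show ?case
    by (rule Ck_on_SucI[where f' = "\<lambda>x v. dd f x v + dd g x v"])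
       (use Suc in \<open>auto intro!: has_derivative_add has_derivative_dd\<close>)
qed (auto intro: continuous_intros)

lemma Ck_on_bounded_linear:
  assumes "bounded_linear L" "open S"
  shows "Ck_on k S f \<Longrightarrow> Ck_on k S (\<lambda>x. L (f x))"
proof (induction k arbitrary: f)
  case 0
  then show ?case using bounded_linear.continuous_on[OF assms(1)] by simp
next
  case (Suc k)
  show ?case
    by (rule Ck_on_SucI[OF assms(2), where f' = "\<lambda>x v. L (dd f x v)"])
       (use Suc in \<open>auto intro!: bounded_linear.has_derivative[OF assms(1)] has_derivative_dd\<close>)
qed

lemma Ck_on_bounded_bilinear:
  assumes "bounded_bilinear prd" "open S"
  shows "Ck_on k S f \<Longrightarrow> Ck_on k S g \<Longrightarrow> Ck_on k S (\<lambda>x. prd (f x) (g x))"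
proof (induction k arbitrary: f g)
  case 0
  then show ?case using bounded_bilinear.continuous_on[OF assms(1)] by simp
next
  case (Suc k)
  show ?case
  proof (rule Ck_on_SucI[OF assms(2)])
    show "((\<lambda>x. prd (f x) (g x)) has_derivative
        (\<lambda>v. prd (f x) (dd g x v) + prd (dd f x v) (g x))) (at x)" if "x \<in> S" for x
      using Suc.prems that by (intro bounded_bilinear.FDERIV[OF assms(1)]) (auto intro: has_derivative_dd)
    show "Ck_on k S (\<lambda>x. prd (f x) (dd g x v) + prd (dd f x v) (g x))" for v
      using Suc.prems Ck_on_pred[OF Suc.prems(1)] Ck_on_pred[OF Suc.prems(2)]
      by (intro Ck_on_add[OF assms(2)] Suc.IH) auto
  qed
qed

lemmas Ck_on_scaleR = Ck_on_bounded_bilinear[OF bounded_bilinear_scaleR]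
lemmas Ck_on_inner_left = Ck_on_bounded_linear[OF bounded_linear_inner_left]

lemma Ck_on_sum:
  assumes "open S" "\<And>i. i \<in> I \<Longrightarrow> Ck_on k S (f i)"
  shows "Ck_on k S (\<lambda>x. \<Sum>i\<in>I. f i x)"
  using assms(2)
  by (induction I rule: infinite_finite_induct) (auto intro: Ck_on_const Ck_on_add assms(1))

lemma Ck_on_minus: "open S \<Longrightarrow> Ck_on k S f \<Longrightarrow> Ck_on k S (\<lambda>x. - f x)"
  by (rule Ck_on_bounded_linear[OF bounded_linear_minus[OF bounded_linear_ident]])

lemma Ck_on_diff: "open S \<Longrightarrow> Ck_on k S f \<Longrightarrow> Ck_on k S g \<Longrightarrow> Ck_on k S (\<lambda>x. f x - g x)"
  using Ck_on_add[of S k f "\<lambda>x. - g x"] Ck_on_minus[of S k g] by simp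

lemma Ck_on_compose:
  fixes g :: "'a::real_normed_vector \<Rightarrow> 'b::euclidean_space" and f :: "'b \<Rightarrow> 'c::real_normed_vector"
  assumes "open S" "open T" "g ` S \<subseteq> T"
  shows "Ck_on k T f \<Longrightarrow> Ck_on k S g \<Longrightarrow> Ck_on k S (\<lambda>x. f (g x))"
proof (induction k arbitrary: f)
  case 0
  then show ?case using assms(3) by (auto intro: continuous_on_compose2)
next
  case (Suc k)
  have gT: "g x \<in> T" if "x \<in> S" for x using that assms(3) by auto
  show ?case
  proof (rule Ck_on_SucI[OF assms(1)])
    fix x assume x: "x \<in> S"
    have D: "((\<lambda>x. f (g x)) has_derivative (\<lambda>v. dd f (g x) (dd g x v))) (at x)"
      by (rule has_derivative_compose[OF Ck_on_SucD[OF Suc.prems(2) x] Ck_on_SucD[OF Suc.prems(1) gT[OF x]]])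
    have "f differentiable (at (g x))" using Suc.prems(1) gT[OF x] by simp
    with D show "((\<lambda>x. f (g x)) has_derivative (\<lambda>v. \<Sum>i\<in>Basis. (dd g x v \<bullet> i) *\<^sub>R dd f (g x) i)) (at x)"
      by (simp add: linear_basis_expansion[OF linear_dd_arg, of f "g x" "dd g x _"])
  next
    show "Ck_on k S (\<lambda>x. \<Sum>i\<in>Basis. (dd g x v \<bullet> i) *\<^sub>R dd f (g x) i)" for v
      using Suc.prems Ck_on_pred[OF Suc.prems(2)]
      by (intro Ck_on_sum Ck_on_scaleR Ck_on_inner_left Suc.IH assms(1)) auto
  qed
qed

lemma Ck_on_exp: "open S \<Longrightarrow> Ck_on k S f \<Longrightarrow> Ck_on k S (\<lambda>x. exp (f x :: real))"
proof (induction k arbitrary: f)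
  case (Suc k)
  show ?case
  proof (rule Ck_on_SucI[OF Suc.prems(1)])
    show "((\<lambda>x. exp (f x)) has_derivative (\<lambda>v. dd f x v *\<^sub>R exp (f x))) (at x)" if "x \<in> S" for x
      using DERIV_exp[THEN DERIV_compose_FDERIV, OF Ck_on_SucD[OF Suc.prems(2) that]]
      by (simp add: o_def)
    show "Ck_on k S (\<lambda>x. dd f x v *\<^sub>R exp (f x))" for v
      using Suc.prems Suc.IH[OF Suc.prems(1) Ck_on_pred[OF Suc.prems(2)]]
      by (intro Ck_on_scaleR) auto
  qed
qed (auto intro: continuous_intros)

subsection \<open>Solutions of linear systems\<close>

lemma linear_family_bounded_below:
  fixes L :: "'a::real_normed_vector \<Rightarrow> 'e::euclidean_space \<Rightarrow> 'e"
  assumes S: "open S" "x \<in> S" and lin: "\<And>y. y \<in> S \<Longrightarrow> linear (L y)" and inj: "inj (L x)"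
    and cont: "\<And>i. continuous_on S (\<lambda>y. L y i)"
  shows "\<exists>m>0. \<forall>\<^sub>F y in at x. \<forall>u. m * norm u \<le> norm (L y u)"
proof -
  obtain B where B: "B > 0" "\<And>u. B * norm u \<le> norm (L x u)"
    using linear_inj_bounded_below_pos[OF lin[OF S(2)] inj] by blast
  define \<epsilon> where "\<epsilon> = B / (2 * DIM('e))"
  have "\<epsilon> > 0" using B(1) by (simp add: \<epsilon>_def)
  have "\<forall>\<^sub>F y in at x. dist (L y i) (L x i) < \<epsilon>" for i
    using cont[of i] S \<open>\<epsilon> > 0\<close> by (auto simp: continuous_on_eq_continuous_at isCont_def tendsto_iff)
  then have "\<forall>\<^sub>F y in at x. \<forall>i\<in>Basis. dist (L y i) (L x i) < \<epsilon>"
    by (intro eventually_ball_finite) auto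
  moreover have "\<forall>\<^sub>F y in at x. y \<in> S"
    using S by (rule eventually_at_in_open')
  ultimately have "\<forall>\<^sub>F y in at x. \<forall>u. B / 2 * norm u \<le> norm (L y u)"
  proof eventually_elim
    case (elim y)
    show ?case
    proof
      fix u
      have *: "L z u = (\<Sum>i\<in>Basis. (u \<bullet> i) *\<^sub>R L z i)" if "z \<in> S" for z
        by (rule linear_basis_expansion[OF lin[OF that]])
      have "norm (L y u - L x u) = norm (\<Sum>i\<in>Basis. (u \<bullet> i) *\<^sub>R (L y i - L x i))"
        using *[OF elim(2)] *[OF S(2)] by (simp add: sum_subtractf scaleR_diff_right)
      also have "\<dots> \<le> (\<Sum>i\<in>(Basis::'e set). norm u * \<epsilon>)"
      proof (rule sum_norm_le)
        fix i :: 'e assume "i \<in> Basis"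
        then have "\<bar>u \<bullet> i\<bar> \<le> norm u" "norm (L y i - L x i) \<le> \<epsilon>"
          using elim(1) by (auto simp: Basis_le_norm dist_norm less_imp_le)
        then show "norm ((u \<bullet> i) *\<^sub>R (L y i - L x i)) \<le> norm u * \<epsilon>" by (simp add: mult_mono)
      qed
      also have "\<dots> = B / 2 * norm u" by (simp add: \<epsilon>_def)
      finally show "B / 2 * norm u \<le> norm (L y u)"
        using B(2)[of u] norm_triangle_ineq2[of "L x u" "L x u - L y u"] by (simp add: norm_minus_commute)
    qed
  qed
  then show ?thesis using B(1) by (intro exI[of _ "B / 2"]) auto
qed

lemma continuous_linear_solve:
  fixes L :: "'a::real_normed_vector \<Rightarrow> 'e::euclidean_space \<Rightarrow> 'e"
  assumes S: "open S" "x \<in> S" and lin: "\<And>y. y \<in> S \<Longrightarrow> linear (L y)" and inj: "inj (L x)"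
    and cont: "\<And>i. continuous_on S (\<lambda>y. L y i)" and a: "continuous_on S a"
    and w: "\<And>y. y \<in> S \<Longrightarrow> L y (w y) = a y"
  shows "isCont w x"
proof -
  obtain m where m: "m > 0" "\<forall>\<^sub>F y in at x. \<forall>u. m * norm u \<le> norm (L y u)"
    using linear_family_bounded_below[OF S lin inj cont] by blast
  have "((\<lambda>y. a y - L y (w x)) \<longlongrightarrow> a x - L x (w x)) (at x)"
    using a cont S by (auto simp: continuous_on_eq_continuous_at isCont_def intro!: tendsto_diff)
  then have "((\<lambda>y. norm (a y - L y (w x)) / m) \<longlongrightarrow> 0) (at x)"
    using w[OF S(2)] m(1) by (auto intro!: tendsto_divide_zero tendsto_norm_zero)
  moreover have "\<forall>\<^sub>F y in at x. norm (w y - w x) \<le> norm (a y - L y (w x)) / m"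
    using m(2) eventually_at_in_open'[OF S]
  proof eventually_elim
    case (elim y)
    then have "m * norm (w y - w x) \<le> norm (L y (w y - w x))" by blast
    then show ?case using elim m(1) by (simp add: linear_diff lin w field_simps)
  qed
  ultimately have "((\<lambda>y. w y - w x) \<longlongrightarrow> 0) (at x)"
    by (rule Lim_null_comparison[rotated])
  then show ?thesis by (simp add: isCont_def LIM_zero_iff)
qed

lemma differentiable_linear_solve:
  fixes L :: "'a::real_normed_vector \<Rightarrow> 'e::euclidean_space \<Rightarrow> 'e"
  assumes S: "open S" "x \<in> S" and lin: "\<And>y. y \<in> S \<Longrightarrow> linear (L y)" and inj: "inj (L x)"
    and cont: "\<And>i. continuous_on S (\<lambda>y. L y i)"
    and dL: "\<And>i. (\<lambda>y. L y i) differentiable (at x)" and da: "a differentiable (at x)"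
    and w: "\<And>y. y \<in> S \<Longrightarrow> L y (w y) = a y"
  shows "w differentiable (at x)"
proof -
  obtain m where m: "m > 0" "\<forall>\<^sub>F y in at x. \<forall>u. m * norm u \<le> norm (L y u)"
    using linear_family_bounded_below[OF S lin inj cont] by blast
  obtain K where K: "linear K" "\<And>u. L x (K u) = u"
    using linear_injective_isomorphism[OF lin[OF S(2)] inj] by blast
  define r' where "r' = (\<lambda>v. dd a x v - dd (\<lambda>y. L y (w x)) x v)"
  have r: "((\<lambda>y. a y - L y (w x)) has_derivative r') (at x)"
    unfolding r'_def by (intro has_derivative_diff has_derivative_dd da dL)
  define w' where "w' = (\<lambda>v. K (r' v))"
  have w': "bounded_linear w'" unfolding w'_def
    by (rule bounded_linear_compose[OF _ has_derivative_bounded_linear[OF r]])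
       (simp add: K(1) linear_conv_bounded_linear[symmetric])
  have w'0: "w' 0 = 0" by (rule linear_0[OF bounded_linear.linear[OF w']])
  have Lw': "L x (w' u) = r' u" for u by (simp add: w'_def K(2))
  define e where "e = (\<lambda>y. (a y - L y (w x)) - L y (w' (y - x)))"
  have L0: "dd (\<lambda>y. L y 0) x u = 0" for u
    using dd_cong_open[OF S, of "\<lambda>y. L y 0" "\<lambda>_. 0"] lin linear_0 dd_const by metis
  have "((\<lambda>y. L y (w' (y - x))) has_derivative
      (\<lambda>u. L x (w' u) + dd (\<lambda>q. L q (w' (x - x))) x u)) (at x)"
    by (rule has_derivative_linear_family[OF S S(1) _ lin dL has_derivative_ident])
       (auto intro!: bounded_linear.has_derivative[OF w'] derivative_eq_intros)
  then have "(e has_derivative (\<lambda>u. r' u - (L x (w' u) + dd (\<lambda>q. L q (w' (x - x))) x u))) (at x)"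
    unfolding e_def by (intro has_derivative_diff r)
  then have "(e has_derivative (\<lambda>u. 0)) (at x)"
    by (simp add: L0 w'0 Lw')
  moreover have "e x = 0"
    using w[OF S(2)] lin[OF S(2)] linear_0 by (simp add: e_def w'0)
  ultimately have e: "((\<lambda>y. norm (e y) / norm (y - x)) \<longlongrightarrow> 0) (at x)"
    by (simp add: has_derivative_iff_norm)
  have "((\<lambda>y. norm (w y - w x - w' (y - x)) / norm (y - x)) \<longlongrightarrow> 0) (at x)"
  proof (rule Lim_null_comparison)
    show "((\<lambda>y. norm (e y) / norm (y - x) / m) \<longlongrightarrow> 0) (at x)"
      by (rule tendsto_divide_zero[OF e])
    show "\<forall>\<^sub>F y in at x. norm (norm (w y - w x - w' (y - x)) / norm (y - x)) \<le> norm (e y) / norm (y - x) / m"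
      using m(2) eventually_at_in_open'[OF S]
    proof eventually_elim
      case (elim y)
      have "L y (w y - w x - w' (y - x)) = e y"
        using elim(2) by (simp add: e_def linear_diff lin w)
      with elim(1) have "m * norm (w y - w x - w' (y - x)) \<le> norm (e y)" by metis
      then have "norm (w y - w x - w' (y - x)) \<le> norm (e y) / m"
        using m(1) by (simp add: field_simps)
      then have "norm (w y - w x - w' (y - x)) / norm (y - x) \<le> norm (e y) / m / norm (y - x)"
        by (rule divide_right_mono) simp
      also have "\<dots> = norm (e y) / norm (y - x) / m" by (simp only: divide_divide_eq_left mult.commute)
      finally show ?case by simp
    qed
  qed
  then show ?thesis using w' by (auto simp: differentiable_def has_derivative_iff_norm)
qed

text \<open>Differentiating \<open>L y (w y) = a y\<close> exhibits the derivative of \<open>w\<close> as the solution of a system with the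
  same matrix, so that the induction applies to it.\<close>

lemma Ck_on_linear_solve:
  fixes L :: "'a::real_normed_vector \<Rightarrow> 'e::euclidean_space \<Rightarrow> 'e"
  assumes S: "open S" and lin: "\<And>y. y \<in> S \<Longrightarrow> linear (L y)" and inj: "\<And>y. y \<in> S \<Longrightarrow> inj (L y)"
    and L: "\<And>k i. Ck_on k S (\<lambda>y. L y i)"
  shows "Ck_on k S a \<Longrightarrow> (\<And>y. y \<in> S \<Longrightarrow> L y (w y) = a y) \<Longrightarrow> Ck_on k S w"
proof (induction k arbitrary: a w)
  case 0
  have "isCont w x" if "x \<in> S" for x
    by (rule continuous_linear_solve[where L = L and a = a, OF S that lin inj[OF that] _ _ 0(2)])
       (use L[of 0] 0(1) in auto)
  then show ?case using S by (simp add: continuous_on_eq_continuous_at)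
next
  case (Suc k)
  have dL: "(\<lambda>y. L y i) differentiable (at x)" if "x \<in> S" for x i using L[of 1 i] that by simp
  have dw: "w differentiable (at x)" if "x \<in> S" for x
    using differentiable_linear_solve[OF S that lin inj[OF that] _ dL[OF that] _ Suc.prems(2)]
      L[of 0] Suc.prems(1) that by simp
  have "Ck_on k S w" using Suc.IH[OF Ck_on_pred[OF Suc.prems(1)] Suc.prems(2)] .
  have "Ck_on k S (\<lambda>x. dd w x v)" for v
  proof (rule Suc.IH)
    show "Ck_on k S (\<lambda>x. dd a x v - (\<Sum>i\<in>Basis. (w x \<bullet> i) *\<^sub>R dd (\<lambda>y. L y i) x v))"
      using Suc.prems(1) L[of "Suc k"] \<open>Ck_on k S w\<close>
      by (intro Ck_on_diff Ck_on_sum Ck_on_scaleR Ck_on_inner_left S) auto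
    fix x assume x: "x \<in> S"
    have "((\<lambda>y. L y (w y)) has_derivative (\<lambda>u. L x (dd w x u) + dd (\<lambda>q. L q (w x)) x u)) (at x)"
      by (rule has_derivative_linear_family[OF S x S _ lin dL[OF x] has_derivative_ident has_derivative_dd[OF dw[OF x]]])
         auto
    then have "dd (\<lambda>y. L y (w y)) x v = L x (dd w x v) + dd (\<lambda>q. L q (w x)) x v" by (rule dd_eqI)
    moreover have "dd (\<lambda>y. L y (w y)) x v = dd a x v" by (rule dd_cong_open[OF S x Suc.prems(2)])
    moreover have "dd (\<lambda>q. L q (w x)) x v = (\<Sum>i\<in>Basis. (w x \<bullet> i) *\<^sub>R dd (\<lambda>y. L y i) x v)"
      by (rule linear_basis_expansion[OF linear_dd[OF S x lin dL[OF x]]])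
    ultimately show "L x (dd w x v) = dd a x v - (\<Sum>i\<in>Basis. (w x \<bullet> i) *\<^sub>R dd (\<lambda>y. L y i) x v)"
      by simp
  qed
  then show ?case using dw by simp
qed

subsection \<open>Smooth functions\<close>

lemma smooth_on_cong: "open S \<Longrightarrow> (\<And>x. x \<in> S \<Longrightarrow> f x = g x) \<Longrightarrow> smooth_on S f \<Longrightarrow> smooth_on S g"
  unfolding smooth_on_def using Ck_on_cong by blast

lemma smooth_on_subset: "T \<subseteq> S \<Longrightarrow> smooth_on S f \<Longrightarrow> smooth_on T f"
  unfolding smooth_on_def using Ck_on_subset by blast

lemma smooth_on_differentiable: "smooth_on S f \<Longrightarrow> x \<in> S \<Longrightarrow> f differentiable (at x)"
  unfolding smooth_on_def by (meson Ck_on.simps(2))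

lemma smooth_on_dd: "smooth_on S f \<Longrightarrow> smooth_on S (\<lambda>x. dd f x v)"
  unfolding smooth_on_def using Ck_on.simps(2) by blast

lemma smooth_on_add: "open S \<Longrightarrow> smooth_on S f \<Longrightarrow> smooth_on S g \<Longrightarrow> smooth_on S (\<lambda>x. f x + g x)"
  and smooth_on_diff: "open S \<Longrightarrow> smooth_on S f \<Longrightarrow> smooth_on S g \<Longrightarrow> smooth_on S (\<lambda>x. f x - g x)"
  and smooth_on_sum: "open S \<Longrightarrow> (\<And>i. i \<in> I \<Longrightarrow> smooth_on S (F i)) \<Longrightarrow> smooth_on S (\<lambda>x. \<Sum>i\<in>I. F i x)"
  and smooth_on_const: "open S \<Longrightarrow> smooth_on S (\<lambda>_. c)"
  and smooth_on_bounded_linear: "open S \<Longrightarrow> bounded_linear T \<Longrightarrow> smooth_on S f \<Longrightarrow> smooth_on S (\<lambda>x. T (f x))"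
  by (auto simp: smooth_on_def intro: Ck_on_add Ck_on_diff Ck_on_sum Ck_on_const Ck_on_bounded_linear)

lemma smooth_on_scaleR: "open S \<Longrightarrow> smooth_on S f \<Longrightarrow> smooth_on S g \<Longrightarrow> smooth_on S (\<lambda>x. f x *\<^sub>R g x)"
  and smooth_on_exp: "open S \<Longrightarrow> smooth_on S f \<Longrightarrow> smooth_on S (\<lambda>x. exp (f x :: real))"
  by (auto simp: smooth_on_def intro: Ck_on_scaleR Ck_on_exp)

lemma smooth_on_compose:
  fixes g :: "'a::real_normed_vector \<Rightarrow> 'b::euclidean_space"
  assumes "open S" "open T" "g ` S \<subseteq> T" "smooth_on T f" "smooth_on S g"
  shows "smooth_on S (\<lambda>x. f (g x))"
  using assms Ck_on_compose unfolding smooth_on_def by blast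

lemma smooth_on_linear_family:
  fixes Q :: "'x::real_normed_vector \<Rightarrow> 'a::euclidean_space \<Rightarrow> 'c::real_normed_vector"
  assumes S: "open S" and lin: "\<And>x. x \<in> S \<Longrightarrow> linear (Q x)"
    and Q: "\<And>u. smooth_on S (\<lambda>x. Q x u)" and a: "smooth_on S a"
  shows "smooth_on S (\<lambda>x. Q x (a x))"
proof (rule smooth_on_cong[OF S])
  show "smooth_on S (\<lambda>x. \<Sum>i\<in>Basis. (a x \<bullet> i) *\<^sub>R Q x i)"
    using a Q by (intro smooth_on_sum smooth_on_scaleR S smooth_on_bounded_linear[OF S bounded_linear_inner_left])
  fix x assume "x \<in> S"
  show "(\<Sum>i\<in>Basis. (a x \<bullet> i) *\<^sub>R Q x i) = Q x (a x)"
    by (rule linear_basis_expansion[OF lin[OF \<open>x \<in> S\<close>], symmetric])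
qed

lemma smooth_on_bilinear_family:
  fixes Q :: "'x::real_normed_vector \<Rightarrow> 'a::euclidean_space \<Rightarrow> 'b::euclidean_space \<Rightarrow> 'c::real_normed_vector"
  assumes S: "open S" and "\<And>x. x \<in> S \<Longrightarrow> bilinear (Q x)"
    and "\<And>u v. smooth_on S (\<lambda>x. Q x u v)" "smooth_on S a" "smooth_on S b"
  shows "smooth_on S (\<lambda>x. Q x (a x) (b x))"
proof (rule smooth_on_linear_family[OF S _ _ assms(5)])
  show "linear (Q x (a x))" if "x \<in> S" for x using assms(2)[OF that] by (simp add: bilinear_def)
  show "smooth_on S (\<lambda>x. Q x (a x) u)" for u
    by (rule smooth_on_linear_family[OF S _ _ assms(4), of "\<lambda>x v. Q x v u"])
       (use assms(2,3) in \<open>auto simp: bilinear_def\<close>)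
qed

subsection \<open>Raising indices\<close>

definition pos_def_form :: "('e::euclidean_space \<Rightarrow> 'e \<Rightarrow> real) \<Rightarrow> bool" where
  "pos_def_form b \<longleftrightarrow> bilinear b \<and> (\<forall>u. u \<noteq> 0 \<longrightarrow> b u u > 0)"

lemma pos_def_form_linear_right: "pos_def_form b \<Longrightarrow> linear (b u)"
  and pos_def_form_linear_left: "pos_def_form b \<Longrightarrow> linear (\<lambda>u. b u v)"
  by (auto simp: pos_def_form_def bilinear_def)

lemma linear_inner_basis_sum:
  fixes \<alpha> :: "'e::euclidean_space \<Rightarrow> real"
  assumes "linear \<alpha>"
  shows "(\<Sum>i\<in>Basis. \<alpha> i *\<^sub>R i) \<bullet> z = \<alpha> z"
  by (subst (2) linear_basis_expansion[OF assms])
    (simp add: inner_sum_left inner_commute[of z] mult.commute)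

lemma pos_def_form_injective:
  assumes b: "pos_def_form b" and eq: "\<And>z. b w z = b w' z"
  shows "w = w'"
proof (rule ccontr)
  assume "w \<noteq> w'"
  then have "b (w - w') (w - w') > 0" using b by (simp add: pos_def_form_def)
  moreover have "b (w - w') (w - w') = 0"
    using eq linear_diff[OF pos_def_form_linear_left[OF b]] by simp
  ultimately show False by simp
qed

definition lower :: "('e::euclidean_space \<Rightarrow> 'e \<Rightarrow> real) \<Rightarrow> 'e \<Rightarrow> 'e" where
  "lower b w = (\<Sum>i\<in>Basis. b w i *\<^sub>R i)"

lemma inner_lower: "pos_def_form b \<Longrightarrow> lower b w \<bullet> z = b w z"
  unfolding lower_def by (rule linear_inner_basis_sum[OF pos_def_form_linear_right])

lemma linear_lower: "pos_def_form b \<Longrightarrow> linear (lower b)"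
  by (rule linearI) (auto simp: lower_def linear_add[OF pos_def_form_linear_left]
      linear_cmul[OF pos_def_form_linear_left] scaleR_add_left sum.distrib scaleR_sum_right)

lemma inj_lower: "pos_def_form b \<Longrightarrow> inj (lower b)"
  by (rule injI) (metis inner_lower pos_def_form_injective)

lemma sharp_eqI:
  assumes "pos_def_form b" "\<And>z. b w z = \<alpha> z"
  shows "sharp b \<alpha> = w"
  unfolding sharp_def using assms pos_def_form_injective[OF assms(1)] by (intro the_equality) auto

lemma sharp_works:
  assumes b: "pos_def_form b" and \<alpha>: "linear \<alpha>"
  shows "b (sharp b \<alpha>) z = \<alpha> z"
proof -
  obtain w where "lower b w = (\<Sum>i\<in>Basis. \<alpha> i *\<^sub>R i)"
    using linear_injective_imp_surjective[OF linear_lower[OF b] inj_lower[OF b]]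
    by (metis surjD)
  then have "b w z = \<alpha> z" for z
    using inner_lower[OF b, of w] linear_inner_basis_sum[OF \<alpha>] by simp
  then show ?thesis using sharp_eqI[OF b, of w \<alpha>] by simp
qed

lemma linear_sharp:
  assumes b: "pos_def_form b" and K: "\<And>u. linear (K u)" "\<And>z. linear (\<lambda>u. K u z)"
  shows "linear (\<lambda>u. sharp b (K u))"
proof -
  note lin = pos_def_form_linear_left[OF b]
  show ?thesis
    by (rule linearI; rule sharp_eqI[OF b])
      (simp_all add: linear_add[OF lin] linear_cmul[OF lin] sharp_works[OF b K(1)]
        linear_add[OF K(2)] linear_cmul[OF K(2)])
qed

lemma trace_wrt_add: "trace_wrt b (\<lambda>u v. B u v + C u v) = trace_wrt b B + trace_wrt b C"
  by (simp add: trace_wrt_def sum.distrib)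

lemma trace_wrt_linear: "linear L \<Longrightarrow> trace_wrt b (\<lambda>u v. L (B u v)) = L (trace_wrt b B)"
  by (simp add: trace_wrt_def linear_sum)

text \<open>The vectors \<open>sharp b (\<lambda>z. j \<bullet> A z)\<close> are orthogonal to the kernel of \<open>A\<close>, and \<open>A\<close> maps them onto
  the whole space, which avoids orthogonal projections.\<close>

lemma sharp_submersion:
  assumes b: "pos_def_form b" and c: "pos_def_form c" and A: "linear A" "surj A"
    and iso: "\<And>u v. (\<And>w. A w = 0 \<Longrightarrow> b u w = 0) \<Longrightarrow> (\<And>w. A w = 0 \<Longrightarrow> b v w = 0) \<Longrightarrow>
      c (A u) (A v) = b u v"
  shows "A (sharp b (\<lambda>z. j \<bullet> A z)) = sharp c (\<lambda>z. j \<bullet> z)"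
proof -
  define s where "s = (\<lambda>j. sharp b (\<lambda>z. j \<bullet> A z))"
  have lin: "linear (\<lambda>z. j \<bullet> A z)" for j
    using linear_compose[OF A(1) bounded_linear.linear[OF bounded_linear_inner_right]] by (simp add: o_def)
  have s: "b (s j) z = j \<bullet> A z" for j z
    unfolding s_def by (rule sharp_works[OF b lin])
  have "linear s" unfolding s_def
    by (rule linear_sharp[OF b lin]) (simp add: bounded_linear.linear[OF bounded_linear_inner_left])
  then have lin_As: "linear (\<lambda>j. A (s j))" using linear_compose[OF _ A(1)] by (simp add: o_def)
  have "inj (\<lambda>j. A (s j))"
  proof (subst linear_injective_0[OF lin_As], intro allI impI)
    fix j assume "A (s j) = 0"
    then have "b (s j) (s j) = 0" by (simp add: s)
    then have "s j = 0" using b by (auto simp: pos_def_form_def)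
    then have "j \<bullet> A z = 0" for z
      using s[of j z] linear_0[OF pos_def_form_linear_left[OF b]] by simp
    then have "j \<bullet> j = 0" using A(2) by (metis surjD)
    then show "j = 0" by simp
  qed
  then have surj: "surj (\<lambda>j. A (s j))" using linear_injective_imp_surjective[OF lin_As] by simp
  have "sharp c (\<lambda>z. j \<bullet> z) = A (s j)"
  proof (rule sharp_eqI[OF c])
    fix z
    obtain k where k: "z = A (s k)" using surj by (metis surjD)
    have "c (A (s j)) (A (s k)) = b (s j) (s k)" by (rule iso) (simp_all add: s)
    then show "c (A (s j)) z = j \<bullet> z" by (simp add: k s)
  qed
  then show ?thesis by (simp add: s_def)
qed

lemma trace_wrt_submersion:
  assumes b: "pos_def_form b" and c: "pos_def_form c" and A: "linear A" "surj A"
    and iso: "\<And>u v. (\<And>w. A w = 0 \<Longrightarrow> b u w = 0) \<Longrightarrow> (\<And>w. A w = 0 \<Longrightarrow> b v w = 0) \<Longrightarrow>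
      c (A u) (A v) = b u v"
    and B: "bilinear B"
  shows "trace_wrt b (\<lambda>u v. B (A u) (A v)) = trace_wrt c B"
proof -
  have lin: "linear (\<lambda>z. i \<bullet> z)" for i :: 'a
    by (rule bounded_linear.linear[OF bounded_linear_inner_right])
  define s where "s = (\<lambda>i::'a. sharp b (\<lambda>z. i \<bullet> z))"
  have Br: "linear (B u)" and Bl: "linear (\<lambda>u. B u v)" for u v
    using B by (auto simp: bilinear_def)
  have sum_s: "(\<Sum>i\<in>Basis. (A i \<bullet> j) *\<^sub>R s i) = sharp b (\<lambda>z. j \<bullet> A z)" for j
  proof (rule sharp_eqI[OF b, symmetric])
    fix z
    note l = pos_def_form_linear_left[OF b]
    have "b (\<Sum>i\<in>Basis. (A i \<bullet> j) *\<^sub>R s i) z = (\<Sum>i\<in>Basis. (A i \<bullet> j) * (i \<bullet> z))"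
      by (simp add: linear_sum[OF l] linear_cmul[OF l] s_def sharp_works[OF b lin])
    also have "\<dots> = A (\<Sum>i\<in>Basis. (z \<bullet> i) *\<^sub>R i) \<bullet> j"
      by (simp add: linear_sum[OF A(1)] linear_cmul[OF A(1)] inner_sum_left inner_commute[of z] mult.commute)
    also have "\<dots> = j \<bullet> A z" by (simp add: euclidean_representation inner_commute[of "A z"])
    finally show "b (\<Sum>i\<in>Basis. (A i \<bullet> j) *\<^sub>R s i) z = j \<bullet> A z" .
  qed
  have "B (A i) w = (\<Sum>j\<in>Basis. (A i \<bullet> j) *\<^sub>R B j w)" for i w
    by (rule linear_basis_expansion[OF Bl])
  then have "trace_wrt b (\<lambda>u v. B (A u) (A v)) = (\<Sum>i\<in>Basis. \<Sum>j\<in>Basis. (A i \<bullet> j) *\<^sub>R B j (A (s i)))"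
    by (simp add: trace_wrt_def s_def)
  also have "\<dots> = (\<Sum>j\<in>Basis. \<Sum>i\<in>Basis. (A i \<bullet> j) *\<^sub>R B j (A (s i)))" by (rule sum.swap)
  also have "\<dots> = (\<Sum>j\<in>Basis. B j (A (\<Sum>i\<in>Basis. (A i \<bullet> j) *\<^sub>R s i)))"
    by (simp add: linear_sum[OF A(1)] linear_cmul[OF A(1)] linear_sum[OF Br] linear_cmul[OF Br])
  also have "\<dots> = trace_wrt c B"
    using sharp_submersion[OF b c A iso] by (simp add: trace_wrt_def sum_s)
  finally show ?thesis .
qed

subsection \<open>Riemannian metrics on open sets\<close>

definition metric_on :: "'e::euclidean_space set \<Rightarrow> 'e metric \<Rightarrow> bool" where
  "metric_on S G \<longleftrightarrow> open S \<and> (\<forall>x\<in>S. pos_def_form (G x)) \<and> (\<forall>u v. smooth_on S (\<lambda>x. G x u v))"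

lemma metric_onD:
  assumes "metric_on S G"
  shows "open S" "x \<in> S \<Longrightarrow> pos_def_form (G x)" "smooth_on S (\<lambda>x. G x u v)"
  using assms by (auto simp: metric_on_def)

lemma smooth_on_sharp:
  assumes G: "metric_on S G" and lin: "\<And>x. x \<in> S \<Longrightarrow> linear (\<alpha> x)"
    and \<alpha>: "\<And>z. smooth_on S (\<lambda>x. \<alpha> x z)"
  shows "smooth_on S (\<lambda>x. sharp (G x) (\<alpha> x))"
proof -
  note S = metric_onD(1)[OF G] and pd = metric_onD(2)[OF G]
  have "Ck_on k S (\<lambda>x. sharp (G x) (\<alpha> x))" for k
  proof (rule Ck_on_linear_solve[OF S])
    show "linear (lower (G x))" "inj (lower (G x))" if "x \<in> S" for x
      using linear_lower inj_lower pd that by auto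
    show "Ck_on k S (\<lambda>y. lower (G y) u)" for k u
      unfolding lower_def using metric_onD(3)[OF G]
      by (intro Ck_on_sum Ck_on_scaleR Ck_on_const S) (simp add: smooth_on_def)
    show "Ck_on k S (\<lambda>x. \<Sum>i\<in>Basis. \<alpha> x i *\<^sub>R i)"
      using \<alpha> by (intro Ck_on_sum Ck_on_scaleR Ck_on_const S) (simp add: smooth_on_def)
    show "lower (G x) (sharp (G x) (\<alpha> x)) = (\<Sum>i\<in>Basis. \<alpha> x i *\<^sub>R i)" if "x \<in> S" for x
      using pd[OF that] lin[OF that] by (simp add: lower_def sharp_works)
  qed
  then show ?thesis by (simp add: smooth_on_def)
qed

definition koszul :: "'e::euclidean_space metric \<Rightarrow> 'e \<Rightarrow> 'e \<Rightarrow> 'e \<Rightarrow> 'e \<Rightarrow> real" where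
  "koszul G x u v z = (dd (\<lambda>y. G y v z) x u + dd (\<lambda>y. G y u z) x v - dd (\<lambda>y. G y u v) x z) / 2"

lemma christoffel_koszul: "christoffel G x u v = sharp (G x) (koszul G x u v)"
  by (simp add: christoffel_def koszul_def[abs_def])

lemma linear_koszul:
  assumes G: "metric_on S G" and x: "x \<in> S"
  shows "linear (koszul G x u v)" "linear (\<lambda>u. koszul G x u v z)" "linear (\<lambda>v. koszul G x u v z)"
proof -
  have dG: "(\<lambda>y. G y u v) differentiable (at x)" for u v
    using metric_onD(3)[OF G] smooth_on_differentiable x by blast
  have "bilinear (\<lambda>u v. dd (\<lambda>y. G y u v) x w)" for w
    by (rule bilinear_dd[OF metric_onD(1)[OF G] x _ dG])
      (use metric_onD(2)[OF G] in \<open>auto simp: pos_def_form_def\<close>)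
  then have 1: "linear (\<lambda>u. dd (\<lambda>y. G y u v) x w)" "linear (\<lambda>v. dd (\<lambda>y. G y u v) x w)" for u v w
    by (auto simp: bilinear_def)
  have 2: "linear (\<lambda>w. dd (\<lambda>y. G y u v) x w)" for u v
    by (rule linear_dd_arg[OF dG])
  have half: "linear (\<lambda>u. k u / 2)" if "linear k" for k :: "'a \<Rightarrow> real"
    using linear_compose_scale_right[OF that, of "1/2"] by simp
  show "linear (koszul G x u v)" "linear (\<lambda>u. koszul G x u v z)" "linear (\<lambda>v. koszul G x u v z)"
    unfolding koszul_def[abs_def]
    by (intro half linear_compose_add linear_compose_sub 1 2)+
qed

lemma bilinear_christoffel:
  assumes "metric_on S G" "x \<in> S"
  shows "bilinear (christoffel G x)"
  unfolding bilinear_def christoffel_koszul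
  by (intro conjI allI linear_sharp linear_koszul[OF assms] metric_onD(2)[OF assms])

lemma smooth_on_christoffel:
  assumes G: "metric_on S G"
  shows "smooth_on S (\<lambda>x. christoffel G x u v)"
  unfolding christoffel_koszul
proof (rule smooth_on_sharp[OF G linear_koszul(1)[OF G]])
  note S = metric_onD(1)[OF G]
  have "smooth_on S (\<lambda>x. (1/2) *\<^sub>R (dd (\<lambda>y. G y v z) x u + dd (\<lambda>y. G y u z) x v - dd (\<lambda>y. G y u v) x z))" for z
    by (intro smooth_on_scaleR smooth_on_const smooth_on_add smooth_on_diff smooth_on_dd metric_onD(3)[OF G] S)
  then show "smooth_on S (\<lambda>x. koszul G x u v z)" for z by (simp add: koszul_def)
qed

lemma smooth_on_christoffel_along:
  fixes f :: "'a::real_normed_vector \<Rightarrow> 'e::euclidean_space"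
  assumes G: "metric_on T G" and S: "open S" "f ` S \<subseteq> T"
    and f: "smooth_on S f" "smooth_on S a" "smooth_on S b"
  shows "smooth_on S (\<lambda>x. christoffel G (f x) (a x) (b x))"
  by (rule smooth_on_bilinear_family[OF S(1)])
    (use assms bilinear_christoffel[OF G] smooth_on_compose[OF S(1) metric_onD(1)[OF G] S(2) smooth_on_christoffel[OF G]] in auto)

subsection \<open>Covariant derivatives in coordinates\<close>

definition cov_deriv ::
  "'f::euclidean_space metric \<Rightarrow> ('e::euclidean_space \<Rightarrow> 'f) \<Rightarrow> ('e \<Rightarrow> 'f) \<Rightarrow> 'e \<Rightarrow> 'e \<Rightarrow> 'f" where
  "cov_deriv H f V x w = dd V x w + christoffel H (f x) (dd f x w) (V x)"

lemma second_fundamental_form_eq: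
  "second_fundamental_form G H f x u v =
     cov_deriv H f (\<lambda>y. dd f y v) x u - dd f x (christoffel G x u v)"
  by (simp add: second_fundamental_form_def pullback_conn_def levi_civita_def cov_deriv_def dd_const)

lemma second_cov_deriv_eq:
  "second_cov_deriv G H f V x u v =
     cov_deriv H f (\<lambda>y. cov_deriv H f V y v) x u - cov_deriv H f V x (christoffel G x u v)"
  by (simp add: second_cov_deriv_def pullback_conn_def levi_civita_def cov_deriv_def dd_const)

lemma linear_cov_deriv:
  assumes "bilinear (christoffel H (f x))" "f differentiable (at x)" "V differentiable (at x)"
  shows "linear (cov_deriv H f V x)"
proof -
  have "linear (\<lambda>u. christoffel H (f x) u (V x))" using assms(1) by (simp add: bilinear_def)
  from linear_compose[OF linear_dd_arg[OF assms(2)] this]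
  have "linear (\<lambda>w. christoffel H (f x) (dd f x w) (V x))" by (simp add: o_def)
  then show ?thesis unfolding cov_deriv_def[abs_def]
    using linear_dd_arg[OF assms(3)] by (intro linear_compose_add)
qed

lemma linear_cov_deriv_family:
  assumes S: "open S" "x \<in> S" and H: "bilinear (christoffel H (f x))"
    and lin: "\<And>y. y \<in> S \<Longrightarrow> linear (Q y)" and dQ: "\<And>v. (\<lambda>y. Q y v) differentiable (at x)"
  shows "linear (\<lambda>v. cov_deriv H f (\<lambda>y. Q y v) x u)"
proof -
  have "linear (christoffel H (f x) (dd f x u))" using H by (simp add: bilinear_def)
  from linear_compose[OF lin[OF S(2)] this]
  have "linear (\<lambda>v. christoffel H (f x) (dd f x u) (Q x v))" by (simp add: o_def)
  then show ?thesis unfolding cov_deriv_def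
    using linear_dd[OF S lin dQ] by (intro linear_compose_add)
qed

lemma smooth_on_cov_deriv:
  fixes f :: "'e::euclidean_space \<Rightarrow> 'f::euclidean_space"
  assumes H: "metric_on T H" and S: "open S" "f ` S \<subseteq> T"
    and f: "smooth_on S f" and V: "smooth_on S V"
  shows "smooth_on S (\<lambda>x. cov_deriv H f V x w)"
  unfolding cov_deriv_def
  by (intro smooth_on_add smooth_on_christoffel_along[OF H] S f V smooth_on_dd)

lemma curvature_at_eq:
  assumes "bilinear (christoffel H x)"
  shows "curvature_at H x u v w =
    dd (\<lambda>y. christoffel H y v w) x u + christoffel H x u (christoffel H x v w)
    - (dd (\<lambda>y. christoffel H y u w) x v + christoffel H x v (christoffel H x u w))"
proof -
  have "christoffel H x 0 w = 0" using assms by (simp add: bilinear_lzero)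
  then show ?thesis
    by (simp add: curvature_at_def curvature_def levi_civita_def lie_bracket_def dd_const)
qed

lemma bilinear_curvature_at:
  assumes H: "metric_on S H" and x: "x \<in> S"
  shows "bilinear (\<lambda>u w. curvature_at H x u v w)"
proof -
  note S = metric_onD(1)[OF H]
  have bil: "bilinear (christoffel H y)" if "y \<in> S" for y
    using bilinear_christoffel[OF H that] .
  have dC: "(\<lambda>y. christoffel H y u v) differentiable (at x)" for u v
    using smooth_on_differentiable[OF smooth_on_christoffel[OF H] x] .
  have "bilinear (\<lambda>u w. dd (\<lambda>y. christoffel H y u w) x v)" for v
    by (rule bilinear_dd[OF S x bil dC])
  then have 1: "linear (\<lambda>u. dd (\<lambda>y. christoffel H y u w) x v)"
      "linear (\<lambda>w. dd (\<lambda>y. christoffel H y u w) x v)" for u v w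
    by (auto simp: bilinear_def)
  have 2: "linear (\<lambda>u. dd (\<lambda>y. christoffel H y v w) x u)" for v w
    by (rule linear_dd_arg[OF dC])
  have 3: "linear (\<lambda>w. christoffel H x u w)" "linear (\<lambda>u. christoffel H x u w)" for u w
    using bil[OF x] by (auto simp: bilinear_def)
  have 4: "linear (\<lambda>w. christoffel H x u (christoffel H x v w))" "linear (\<lambda>w. christoffel H x v (christoffel H x w u))"
    for u v
    using linear_compose[OF 3(1) 3(1)] linear_compose[OF 3(2) 3(1)] by (auto simp: o_def)
  show ?thesis unfolding bilinear_def curvature_at_eq[OF bil[OF x]]
    by (intro conjI allI linear_compose_add linear_compose_sub 1 2 3 4)
qed

lemma bilinear_compose_linear:
  assumes "bilinear B" "linear L"
  shows "bilinear (\<lambda>u v. B (L u) (L v))"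
  using assms linear_compose[OF assms(2)] by (auto simp: bilinear_def o_def)

lemma metric_on_subset: "metric_on S G \<Longrightarrow> open T \<Longrightarrow> T \<subseteq> S \<Longrightarrow> metric_on T G"
  unfolding metric_on_def using smooth_on_subset by blast

subsection \<open>Composition with a harmonic Riemannian submersion\<close>

locale harmonic_submersion_composite =
  fixes U :: "'e::euclidean_space set" and V :: "'f::euclidean_space set" and W :: "'k::euclidean_space set"
    and G :: "'e metric" and H :: "'f metric" and H' :: "'k metric"
    and f :: "'e \<Rightarrow> 'f" and \<psi> :: "'f \<Rightarrow> 'k" and F :: "'e \<Rightarrow> 'k"
  assumes open_U: "open U" and pos_def_G: "x \<in> U \<Longrightarrow> pos_def_form (G x)"
    and metric_H: "metric_on V H" and metric_H': "metric_on W H'"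
    and f: "smooth_on U f" "f ` U \<subseteq> V" and \<psi>: "smooth_on V \<psi>" "\<psi> ` V \<subseteq> W"
    and F_eq: "x \<in> U \<Longrightarrow> F x = \<psi> (f x)"
    and tension_0: "x \<in> U \<Longrightarrow> tension G H f x = 0"
    and surj_df: "x \<in> U \<Longrightarrow> surj (dd f x)"
    and isometry: "x \<in> U \<Longrightarrow> (\<And>w. dd f x w = 0 \<Longrightarrow> G x u w = 0) \<Longrightarrow>
      (\<And>w. dd f x w = 0 \<Longrightarrow> G x v w = 0) \<Longrightarrow> H (f x) (dd f x u) (dd f x v) = G x u v"
begin

lemmas open_V = metric_onD(1)[OF metric_H]

lemma f_in_V: "x \<in> U \<Longrightarrow> f x \<in> V"
  using f(2) by auto

lemma \<psi>_in_W: "q \<in> V \<Longrightarrow> \<psi> q \<in> W"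
  using \<psi>(2) by auto

lemma f_differentiable: "x \<in> U \<Longrightarrow> f differentiable (at x)"
  using smooth_on_differentiable f(1) by blast

lemma dd_pullback:
  assumes x: "x \<in> U" and Z: "\<And>y. y \<in> U \<Longrightarrow> Z y = Y (f y)" and Y: "Y differentiable (at (f x))"
  shows "dd Z x u = dd Y (f x) (dd f x u)"
proof -
  have "dd Z x u = dd (\<lambda>y. Y (f y)) x u" by (rule dd_cong_open[OF open_U x Z])
  also have "\<dots> = dd Y (f x) (dd f x u)"
    by (rule dd_eqI[OF has_derivative_compose[OF has_derivative_dd[OF f_differentiable[OF x]] has_derivative_dd[OF Y]]])
  finally show ?thesis .
qed

lemma dd_F: "x \<in> U \<Longrightarrow> dd F x u = dd \<psi> (f x) (dd f x u)"
  by (rule dd_pullback[where Y = \<psi>, OF _ F_eq]) (auto intro: smooth_on_differentiable[OF \<psi>(1)] f_in_V)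

lemma cov_deriv_pullback:
  assumes x: "x \<in> U" and Z: "\<And>y. y \<in> U \<Longrightarrow> Z y = Y (f y)" and Y: "Y differentiable (at (f x))"
  shows "cov_deriv H' F Z x u = cov_deriv H' \<psi> Y (f x) (dd f x u)"
  unfolding cov_deriv_def using dd_pullback[OF x Z Y] dd_F[OF x] F_eq[OF x] Z[OF x] by simp

text \<open>For \<open>Q = d\<psi>\<close> this is \<open>\<nabla>d\<psi>\<close>; for \<open>Q = \<nabla>\<^sup>\<psi>\<tau>(\<psi>)\<close> it is \<open>(\<nabla>\<^sup>\<psi>)\<^sup>2\<tau>(\<psi>)\<close>.\<close>

definition cov_hessian :: "('f \<Rightarrow> 'f \<Rightarrow> 'k) \<Rightarrow> 'f \<Rightarrow> 'f \<Rightarrow> 'f \<Rightarrow> 'k" where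
  "cov_hessian Q q a b = cov_deriv H' \<psi> (\<lambda>r. Q r b) q a - Q q (christoffel H q a b)"

context
  fixes Q :: "'f \<Rightarrow> 'f \<Rightarrow> 'k"
  assumes linear_Q: "\<And>q. q \<in> V \<Longrightarrow> linear (Q q)" and smooth_Q: "\<And>w. smooth_on V (\<lambda>q. Q q w)"
begin

lemma cov_deriv_pullback_form:
  assumes x: "x \<in> U" and Z: "\<And>y. y \<in> U \<Longrightarrow> Z y = Q (f y) (dd f y v)"
  shows "cov_deriv H' F Z x u - Q (f x) (dd f x (christoffel G x u v)) =
    cov_hessian Q (f x) (dd f x u) (dd f x v) + Q (f x) (second_fundamental_form G H f x u v)"
proof -
  have dQ: "(\<lambda>q. Q q w) differentiable (at (f x))" for w
    using smooth_on_differentiable[OF smooth_Q f_in_V[OF x]] .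
  have ddf: "(\<lambda>y. dd f y v) differentiable (at x)"
    using smooth_on_differentiable[OF smooth_on_dd[OF f(1)] x] .
  have "dd Z x u = dd (\<lambda>y. Q (f y) (dd f y v)) x u" by (rule dd_cong_open[OF open_U x Z])
  also have "\<dots> = Q (f x) (dd (\<lambda>y. dd f y v) x u) + dd (\<lambda>q. Q q (dd f x v)) (f x) (dd f x u)"
    by (rule dd_eqI[OF has_derivative_linear_family[OF open_U x open_V f(2) linear_Q dQ
        has_derivative_dd[OF f_differentiable[OF x]] has_derivative_dd[OF ddf]]])
  finally have "cov_deriv H' F Z x u = Q (f x) (dd (\<lambda>y. dd f y v) x u) +
      cov_deriv H' \<psi> (\<lambda>q. Q q (dd f x v)) (f x) (dd f x u)"
    by (simp add: cov_deriv_def dd_F[OF x] F_eq[OF x] Z[OF x])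
  then show ?thesis
    using linear_Q[OF f_in_V[OF x]]
    by (simp add: cov_hessian_def second_fundamental_form_eq cov_deriv_def[of H] linear_add linear_diff)
qed

lemma bilinear_cov_hessian:
  assumes q: "q \<in> V"
  shows "bilinear (cov_hessian Q q)"
proof -
  have H'q: "bilinear (christoffel H' (\<psi> q))"
    by (rule bilinear_christoffel[OF metric_H' \<psi>_in_W[OF q]])
  have dQ: "(\<lambda>q. Q q w) differentiable (at q)" for w
    using smooth_on_differentiable[OF smooth_Q q] .
  have 1: "linear (\<lambda>b. cov_deriv H' \<psi> (\<lambda>r. Q r b) q a)" for a
    by (rule linear_cov_deriv_family[where Q = Q and f = \<psi>, OF open_V q H'q linear_Q dQ])
  have 2: "linear (\<lambda>a. cov_deriv H' \<psi> (\<lambda>r. Q r b) q a)" for b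
    using linear_cov_deriv[where f = \<psi>, OF H'q smooth_on_differentiable[OF \<psi>(1) q] dQ] by simp
  have "linear (\<lambda>b. christoffel H q a b)" "linear (\<lambda>a. christoffel H q a b)" for a b
    using bilinear_christoffel[OF metric_H q] by (auto simp: bilinear_def)
  then have 3: "linear (\<lambda>b. Q q (christoffel H q a b))" "linear (\<lambda>a. Q q (christoffel H q a b))" for a b
    using linear_compose[OF _ linear_Q[OF q]] by (auto simp: o_def)
  show ?thesis unfolding bilinear_def cov_hessian_def
    by (intro conjI allI linear_compose_sub 1 2 3)
qed

lemma smooth_on_cov_hessian: "smooth_on V (\<lambda>q. cov_hessian Q q a b)"
  unfolding cov_hessian_def
  by (rule smooth_on_diff[OF open_V smooth_on_cov_deriv[OF metric_H' open_V \<psi>(2,1) smooth_Q]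
      smooth_on_linear_family[OF open_V linear_Q smooth_Q smooth_on_christoffel[OF metric_H]]])

lemma trace_cov_hessian:
  assumes x: "x \<in> U" and Z: "\<And>v y. y \<in> U \<Longrightarrow> Z v y = Q (f y) (dd f y v)"
  shows "trace_wrt (G x) (\<lambda>u v. cov_deriv H' F (Z v) x u - Q (f x) (dd f x (christoffel G x u v)))
    = trace_wrt (H (f x)) (cov_hessian Q (f x))"
proof -
  note fx = f_in_V[OF x]
  have "trace_wrt (G x) (\<lambda>u v. cov_deriv H' F (Z v) x u - Q (f x) (dd f x (christoffel G x u v)))
    = trace_wrt (G x) (\<lambda>u v. cov_hessian Q (f x) (dd f x u) (dd f x v)) + Q (f x) (tension G H f x)"
    using cov_deriv_pullback_form[OF x Z]
    by (simp add: trace_wrt_add trace_wrt_linear[OF linear_Q[OF fx]] tension_def)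
  also have "\<dots> = trace_wrt (H (f x)) (cov_hessian Q (f x))"
    using trace_wrt_submersion[OF pos_def_G[OF x] metric_onD(2)[OF metric_H fx]
        linear_dd_arg[OF f_differentiable[OF x]] surj_df[OF x] isometry[OF x] bilinear_cov_hessian[OF fx]]
    by (simp add: tension_0[OF x] linear_0[OF linear_Q[OF fx]])
  finally show ?thesis .
qed

end

lemma linear_d\<psi>: "q \<in> V \<Longrightarrow> linear (dd \<psi> q)"
  by (rule linear_dd_arg[OF smooth_on_differentiable[OF \<psi>(1)]])

lemma tension_\<psi>: "tension H H' \<psi> q = trace_wrt (H q) (cov_hessian (dd \<psi>) q)"
  by (simp add: tension_def second_fundamental_form_eq[abs_def] cov_hessian_def[abs_def])

lemma tension_composite:
  assumes x: "x \<in> U"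
  shows "tension G H' F x = tension H H' \<psi> (f x)"
  using trace_cov_hessian[where Z = "\<lambda>v y. dd F y v", OF linear_d\<psi> smooth_on_dd[OF \<psi>(1)] x dd_F]
  by (simp add: tension_\<psi> tension_def[of G H'] second_fundamental_form_eq[abs_def] dd_F[OF x])

lemma smooth_on_tension: "smooth_on V (tension H H' \<psi>)"
proof -
  have lin: "linear (\<lambda>z. i \<bullet> z)" for i :: 'f
    by (rule bounded_linear.linear[OF bounded_linear_inner_right])
  have sharp: "smooth_on V (\<lambda>q. sharp (H q) (\<lambda>z. i \<bullet> z))" for i
    by (rule smooth_on_sharp[OF metric_H lin smooth_on_const[OF open_V]])
  have "smooth_on V (\<lambda>q. cov_hessian (dd \<psi>) q i (sharp (H q) (\<lambda>z. i \<bullet> z)))" for i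
    by (rule smooth_on_bilinear_family[OF open_V bilinear_cov_hessian smooth_on_cov_hessian
          smooth_on_const[OF open_V] sharp])
      (auto intro: linear_d\<psi> smooth_on_dd \<psi>(1))
  then have "smooth_on V (\<lambda>q. \<Sum>i\<in>Basis. cov_hessian (dd \<psi>) q i (sharp (H q) (\<lambda>z. i \<bullet> z)))"
    by (rule smooth_on_sum[OF open_V])
  then show ?thesis by (simp add: tension_\<psi>[abs_def] trace_wrt_def)
qed

lemma linear_cov_deriv_tension:
  "q \<in> V \<Longrightarrow> linear (cov_deriv H' \<psi> (tension H H' \<psi>) q)"
  by (intro linear_cov_deriv bilinear_christoffel[OF metric_H'] \<psi>_in_W
      smooth_on_differentiable[OF \<psi>(1)] smooth_on_differentiable[OF smooth_on_tension])

lemma smooth_on_cov_deriv_tension: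
  "smooth_on V (\<lambda>q. cov_deriv H' \<psi> (tension H H' \<psi>) q w)"
  by (intro smooth_on_cov_deriv[OF metric_H'] open_V \<psi> smooth_on_tension)

lemma bitension_composite:
  assumes x: "x \<in> U"
  shows "bitension G H' F x = bitension H H' \<psi> (f x)"
proof -
  note fx = f_in_V[OF x]
  let ?T = "tension H H' \<psi>" and ?R = "curvature_at H' (\<psi> (f x))"
  have cov: "cov_deriv H' F (tension G H' F) y v = cov_deriv H' \<psi> ?T (f y) (dd f y v)" if "y \<in> U" for v y
    by (rule cov_deriv_pullback[OF that tension_composite smooth_on_differentiable[OF smooth_on_tension f_in_V[OF that]]])
  have lap: "rough_laplacian G H' F (tension G H' F) x = rough_laplacian H H' \<psi> ?T (f x)"
    using trace_cov_hessian[where Z = "\<lambda>v y. cov_deriv H' F (tension G H' F) y v",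
        OF linear_cov_deriv_tension smooth_on_cov_deriv_tension x cov]
    by (simp add: rough_laplacian_def second_cov_deriv_eq[abs_def] cov[OF x] cov_hessian_def[abs_def])
  have "bilinear (\<lambda>a b. ?R (dd \<psi> (f x) a) (?T (f x)) (dd \<psi> (f x) b))"
    by (rule bilinear_compose_linear[OF bilinear_curvature_at[OF metric_H' \<psi>_in_W[OF fx]] linear_d\<psi>[OF fx]])
  from trace_wrt_submersion[OF pos_def_G[OF x] metric_onD(2)[OF metric_H fx]
        linear_dd_arg[OF f_differentiable[OF x]] surj_df[OF x] isometry[OF x] this]
  show ?thesis
    by (simp add: bitension_def lap tension_composite[OF x] dd_F[OF x] F_eq[OF x])
qed

end

subsection \<open>Charts\<close>

context
  fixes M :: "('m, 'e::euclidean_space) manifold" and c :: "('m, 'e) chart"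
  assumes M: "smooth_manifold M" and c: "c \<in> atlas M"
begin

lemma homeomorphic_chart:
  "homeomorphic_map (subtopology (topo M) (fst c)) (top_of_set (snd c ` fst c)) (snd c)"
  and openin_chart: "openin (topo M) (fst c)" and open_chart_image: "open (snd c ` fst c)"
  using M c unfolding smooth_manifold_def by auto

lemma chart_inv_chart: "p \<in> fst c \<Longrightarrow> chart_inv c (snd c p) = p"
proof -
  have "inj_on (snd c) (fst c)"
    using homeomorphic_imp_injective_map[OF homeomorphic_chart] openin_subset[OF openin_chart]
    by (simp add: topspace_subtopology inf_absorb2)
  then show "p \<in> fst c \<Longrightarrow> chart_inv c (snd c p) = p" by (rule inv_into_f_f)
qed

lemma open_chart_image_openin:
  assumes "openin (topo M) X"
  shows "open (snd c ` (fst c \<inter> X))"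
proof -
  have "openin (subtopology (topo M) (fst c)) (fst c \<inter> X)"
    using assms by (rule openin_subtopology_Int2)
  then have "openin (top_of_set (snd c ` fst c)) (snd c ` (fst c \<inter> X))"
    using homeomorphic_imp_open_map[OF homeomorphic_chart] by (simp add: open_map_def)
  then show ?thesis using openin_open_trans open_chart_image by blast
qed

lemma metric_on_metric_rep:
  assumes "riemannian_metric M g"
  shows "metric_on (snd c ` fst c) (metric_rep g c)"
proof -
  have "pos_def_form (g c p)" if "p \<in> fst c" for p
    using assms c that unfolding riemannian_metric_def pos_def_form_def by blast
  moreover have "smooth_on (snd c ` fst c) (\<lambda>x. g c (chart_inv c x) u v)" for u v
    using assms c unfolding riemannian_metric_def by blast
  ultimately show ?thesis
    unfolding metric_on_def using open_chart_image chart_inv_chart by (auto simp: metric_rep_def)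
qed

lemma metric_on_conformal_change:
  assumes g: "riemannian_metric M g" and \<rho>: "smooth_fun M \<rho>"
  shows "metric_on (snd c ` fst c) (metric_rep (conformal_change \<rho> g) c)"
proof -
  note m = metric_on_metric_rep[OF g]
  have eq: "metric_rep (conformal_change \<rho> g) c x =
      (\<lambda>u v. exp (2 *\<^sub>R (\<rho> \<circ> chart_inv c) x) *\<^sub>R metric_rep g c x u v)" for x
    by (simp add: metric_rep_def conformal_change_def)
  have "smooth_on (snd c ` fst c) (\<rho> \<circ> chart_inv c)"
    using \<rho> c by (simp add: smooth_fun_def)
  then have "smooth_on (snd c ` fst c) (\<lambda>x. exp (2 *\<^sub>R (\<rho> \<circ> chart_inv c) x) *\<^sub>R metric_rep g c x u v)" for u v
    by (intro smooth_on_scaleR smooth_on_exp smooth_on_const open_chart_image metric_onD(3)[OF m])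
  moreover have "pos_def_form (\<lambda>u v. exp a *\<^sub>R b u v)" if "pos_def_form b" for a and b :: "'e \<Rightarrow> 'e \<Rightarrow> real"
    using that linear_compose_scale_right[of "_ :: 'e \<Rightarrow> real" "exp a"] by (auto simp: pos_def_form_def bilinear_def)
  ultimately show ?thesis
    unfolding metric_on_def eq using open_chart_image metric_onD(2)[OF m] by blast
qed

end

lemma smooth_map_id: "smooth_manifold N \<Longrightarrow> smooth_map N N id"
  by (simp add: smooth_manifold_def smooth_map_def)

lemma submersion_composite_fields:
  fixes M :: "('m, 'e::euclidean_space) manifold" and N :: "('n, 'f::euclidean_space) manifold"
  assumes M: "smooth_manifold M" and g: "riemannian_metric M g"
    and N: "smooth_manifold N" and h: "riemannian_metric N h"
    and sub: "riemannian_submersion M g N h \<pi>" and harm: "harmonic_map M g N h \<pi>"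
    and h': "metric_on (snd d' ` fst d') (metric_rep h' d')"
    and c: "c \<in> atlas M" and d: "d \<in> atlas N" and d': "d' \<in> atlas N"
    and p: "p \<in> fst c" "\<pi> p \<in> fst d" "\<pi> p \<in> fst d'"
  shows "tension_field g h' \<pi> c d' p = tension_field h h' id d d' (\<pi> p)"
    and "bitension_field g h' \<pi> c d' p = bitension_field h h' id d d' (\<pi> p)"
proof -
  have smooth: "smooth_map M N \<pi>" using sub by (simp add: riemannian_submersion_def)
  define X where "X = {q \<in> topspace (topo M). \<pi> q \<in> fst d \<inter> fst d'}"
  define U where "U = snd c ` (fst c \<inter> X)"
  define V where "V = snd d ` (fst d \<inter> fst d')"
  have X: "openin (topo M) X" unfolding X_def
    using smooth openin_chart[OF N d] openin_chart[OF N d']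
    by (intro openin_continuous_map_preimage[of _ "topo N"]) (auto simp: smooth_map_def)
  have fst_c: "fst c \<subseteq> topspace (topo M)" using openin_chart[OF M c] by (rule openin_subset)
  have V: "open V" unfolding V_def by (rule open_chart_image_openin[OF N d openin_chart[OF N d']])
  note inv_c = chart_inv_chart[OF M c] and inv_d = chart_inv_chart[OF N d]
  have f_at: "chart_rep c d \<pi> (snd c q) = snd d (\<pi> q)" if "q \<in> fst c" for q
    by (simp add: chart_rep_def inv_c that)
  interpret harmonic_submersion_composite U V "snd d' ` fst d'" "metric_rep g c" "metric_rep h d"
    "metric_rep h' d'" "chart_rep c d \<pi>" "chart_rep d d' id" "chart_rep c d' \<pi>"
  proof
    show "open U" unfolding U_def by (rule open_chart_image_openin[OF M c X])
    show "pos_def_form (metric_rep g c x)" if "x \<in> U" for x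
      using metric_onD(2)[OF metric_on_metric_rep[OF M c g]] that by (auto simp: U_def)
    show "metric_on V (metric_rep h d)"
      by (rule metric_on_subset[OF metric_on_metric_rep[OF N d h] V]) (auto simp: V_def)
    show "metric_on (snd d' ` fst d') (metric_rep h' d')" by (rule h')
    have "smooth_on (snd c ` (fst c \<inter> \<pi> -` fst d)) (chart_rep c d \<pi>)"
      using smooth c d by (simp add: smooth_map_def)
    then show "smooth_on U (chart_rep c d \<pi>)"
      by (rule smooth_on_subset[rotated]) (auto simp: U_def X_def)
    show "chart_rep c d \<pi> ` U \<subseteq> V" by (auto simp: U_def V_def X_def f_at)
    show "smooth_on V (chart_rep d d' id)"
      using N d d' by (simp add: smooth_manifold_def V_def)
    show "chart_rep d d' id ` V \<subseteq> snd d' ` fst d'" by (auto simp: V_def chart_rep_def inv_d)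
  next
    fix x assume "x \<in> U"
    then obtain q where q: "q \<in> fst c" "\<pi> q \<in> fst d" and x: "x = snd c q"
      by (auto simp: U_def X_def)
    show "chart_rep c d' \<pi> x = chart_rep d d' id (chart_rep c d \<pi> x)"
      using q by (simp add: x chart_rep_def inv_c inv_d)
    show "tension (metric_rep g c) (metric_rep h d) (chart_rep c d \<pi>) x = 0"
      using harm c d q by (auto simp: harmonic_map_def tension_field_def x)
    have diff: "chart_diff c d \<pi> q = dd (chart_rep c d \<pi>) x"
      by (simp add: chart_diff_def[abs_def] x)
    have *: "surj (chart_diff c d \<pi> q)" "\<forall>u\<in>horizontal g c d \<pi> q. \<forall>v\<in>horizontal g c d \<pi> q.
        h d (\<pi> q) (chart_diff c d \<pi> q u) (chart_diff c d \<pi> q v) = g c q u v"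
      using sub c d q unfolding riemannian_submersion_def by auto
    from *(1) show "surj (dd (chart_rep c d \<pi>) x)" by (simp add: diff)
    fix u v
    assume "\<And>w. dd (chart_rep c d \<pi>) x w = 0 \<Longrightarrow> metric_rep g c x u w = 0"
      and "\<And>w. dd (chart_rep c d \<pi>) x w = 0 \<Longrightarrow> metric_rep g c x v w = 0"
    then have "u \<in> horizontal g c d \<pi> q" "v \<in> horizontal g c d \<pi> q"
      by (auto simp: horizontal_def diff metric_rep_def x inv_c q)
    then show "metric_rep h d (chart_rep c d \<pi> x) (dd (chart_rep c d \<pi>) x u) (dd (chart_rep c d \<pi>) x v)
        = metric_rep g c x u v"
      using *(2) by (simp add: diff metric_rep_def x f_at inv_c inv_d q)
  qed
  have "snd c p \<in> U" using p fst_c by (auto simp: U_def X_def)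
  from tension_composite[OF this] bitension_composite[OF this]
  show "tension_field g h' \<pi> c d' p = tension_field h h' id d d' (\<pi> p)"
    and "bitension_field g h' \<pi> c d' p = bitension_field h h' id d d' (\<pi> p)"
    by (simp_all add: tension_field_def bitension_field_def f_at p(1))
qed

theorem corollary2p2:
  fixes M :: "('m, 'e::euclidean_space) manifold" and g :: "('m, 'e) tensor2"
    and N :: "('n, 'f::euclidean_space) manifold" and h h' :: "('n, 'f) tensor2"
    and \<pi> \<pi>' :: "'m \<Rightarrow> 'n" and one :: "'n \<Rightarrow> 'n" and \<rho> :: "'n \<Rightarrow> real"
  assumes "smooth_manifold M" and "riemannian_metric M g"
    and "smooth_manifold N" and "riemannian_metric N h"
    and "riemannian_submersion M g N h \<pi>" and "harmonic_map M g N h \<pi>"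
    and "smooth_fun N \<rho>"
  defines "h' \<equiv> conformal_change \<rho> h" and "one \<equiv> id" and "\<pi>' \<equiv> one \<circ> \<pi>"
  shows "nonharmonic_map M g N h' \<pi>' \<and> biharmonic_map M g N h' \<pi>' \<longleftrightarrow>
         nonharmonic_map N h N h' one \<and> biharmonic_map N h N h' one"
proof -
  have \<pi>': "\<pi>' = \<pi>" by (simp add: \<pi>'_def one_def)
  have smooth: "smooth_map M N \<pi>" "smooth_map N N one"
    using assms(6) smooth_map_id[OF assms(3)] by (simp_all add: harmonic_map_def one_def)
  have fields: "tension_field g h' \<pi> c d' p = tension_field h h' one d d' (\<pi> p)"
    "bitension_field g h' \<pi> c d' p = bitension_field h h' one d d' (\<pi> p)"
    if "c \<in> atlas M" "d \<in> atlas N" "d' \<in> atlas N" "p \<in> fst c" "\<pi> p \<in> fst d" "\<pi> p \<in> fst d'" for c d d' p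
    unfolding one_def h'_def
    by (rule submersion_composite_fields[OF assms(1-6) metric_on_conformal_change[OF assms(3) that(3) assms(4,7)] that])+
  have lift: "\<exists>c\<in>atlas M. \<exists>p\<in>fst c. q = \<pi> p" if "d \<in> atlas N" "q \<in> fst d" for d q
  proof -
    have "q \<in> topspace (topo N)" using that assms(3) by (auto simp: smooth_manifold_def)
    then obtain p where "p \<in> topspace (topo M)" "q = \<pi> p"
      using assms(5) unfolding riemannian_submersion_def by blast
    then show ?thesis using assms(1) by (auto simp: smooth_manifold_def)
  qed
  have one: "one -` A = A" for A by (simp add: one_def)
  have "harmonic_map M g N h' \<pi> \<longleftrightarrow> harmonic_map N h N h' one"
  proof
    assume *: "harmonic_map M g N h' \<pi>"
    show "harmonic_map N h N h' one" unfolding harmonic_map_def one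
    proof (intro conjI smooth ballI)
      fix d d' q assume q: "d \<in> atlas N" "d' \<in> atlas N" "q \<in> fst d \<inter> fst d'"
      then obtain c p where "c \<in> atlas M" "p \<in> fst c" "q = \<pi> p" using lift by blast
      then show "tension_field h h' one d d' q = 0"
        using fields(1)[of c d d' p] * q by (auto simp: harmonic_map_def)
    qed
  next
    assume *: "harmonic_map N h N h' one"
    show "harmonic_map M g N h' \<pi>" unfolding harmonic_map_def
    proof (intro conjI smooth ballI)
      fix c d p assume p: "c \<in> atlas M" "d \<in> atlas N" "p \<in> fst c \<inter> \<pi> -` fst d"
      then have "tension_field h h' one d d (\<pi> p) = 0"
        using * by (auto simp: harmonic_map_def one)
      then show "tension_field g h' \<pi> c d p = 0" using fields(1)[of c d d p] p by auto
    qed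
  qed
  moreover have "biharmonic_map M g N h' \<pi> \<longleftrightarrow> biharmonic_map N h N h' one"
  proof
    assume *: "biharmonic_map M g N h' \<pi>"
    show "biharmonic_map N h N h' one" unfolding biharmonic_map_def one
    proof (intro conjI smooth ballI)
      fix d d' q assume q: "d \<in> atlas N" "d' \<in> atlas N" "q \<in> fst d \<inter> fst d'"
      then obtain c p where "c \<in> atlas M" "p \<in> fst c" "q = \<pi> p" using lift by blast
      then show "bitension_field h h' one d d' q = 0"
        using fields(2)[of c d d' p] * q by (auto simp: biharmonic_map_def)
    qed
  next
    assume *: "biharmonic_map N h N h' one"
    show "biharmonic_map M g N h' \<pi>" unfolding biharmonic_map_def
    proof (intro conjI smooth ballI)
      fix c d p assume p: "c \<in> atlas M" "d \<in> atlas N" "p \<in> fst c \<inter> \<pi> -` fst d"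
      then have "bitension_field h h' one d d (\<pi> p) = 0"
        using * by (auto simp: biharmonic_map_def one)
      then show "bitension_field g h' \<pi> c d p = 0" using fields(2)[of c d d p] p by auto
    qed
  qed
  ultimately show ?thesis using smooth by (simp add: nonharmonic_map_def \<pi>')
qed

end
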